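(* Assume that the following conditions hold: (A1) For every $t\in\mathbb{R}^s$ there exists $y\ge 0$ with $Wy=t$. (A2) There exists $v\in\mathbb{R}^s$ with $W^\top v<q$ componentwise. (A3) $\int_{\mathbb{R}^s}\|z\|\,\mu(\mathrm{d}z)<\infty$. (A4) $\mu$ has a density $\theta$ with respect to Lebesgue measure, and there exist a convex open set $V\subset\mathbb{R}^s$ and constants $r,\rho>0$ such that $\theta\ge r$ almost surely on $V+B_\rho(0)$. (A5) $\eta_0>0$ is such that $\|\hat y^i(\eta_0)\|<\rho$ for all $i\in I^+$, with $\rho$ from (A4). (A6) $q>0$ componentwise. Then $Q_{EE}$ is partially strongly convex with respect to $x$ on $V_{\eta_0}=V\times(-\infty,\eta_0]$, i.e. there is $\kappa>0$ such that for all $(x_1,\eta_1),(x_2,\eta_2)\in V\times(-\infty,\eta_0]$ and all $\lambda\in(0,1)$ $$Q_{EE}\big(\lambda(x_1,\eta_1)+(1-\lambda)(x_2,\eta_2)\big)\le \lambda Q_{EE}(x_1,\eta_1)+(1-\lambda)Q_{EE}(x_2,\eta_2)-\frac{\kappa}{2}\lambda(1-\lambda)\|x_1-x_2\|^2 .$$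
   Context: $W\in\mathbb{R}^{s\times m}$ and $q\in\mathbb{R}^m$ are fixed, $\mu$ is a Borel probability measure on $\mathbb{R}^s$, and $\varphi(t)=\min\{q^\top y \mid Wy=t,\ y\ge 0\}$ for $t\in\mathbb{R}^s$. The expected excess function is $Q_{EE}(x,\eta)=\int_{\mathbb{R}^s}\max\{0,\varphi(z-x)-\eta\}\,\mu(\mathrm{d}z)$ for $(x,\eta)\in\mathbb{R}^s\times\mathbb{R}$. $B_\rho(0)$ is the ball of radius $\rho$ around $0$. Under (A1) and (A2), $\{v\mid W^\top v\le q\}$ is the convex hull of its finitely many extreme points $d_i$, $i\in I=\{1,\dots,N\}$, and $\varphi(t)=\max_{i\in I}d_i^\top t$. Put $K_i=\{z\mid (d_i-d_j)^\top z\ge 0\ \text{for all } j\in I\}$; these are $s$-dimensional pointed polyhedral cones covering $\mathbb{R}^s$, and $\varphi(t)=d_i^\top t$ on $K_i$. Write $K_i=\mathrm{cone}\{t^i_1,\dots,t^i_{n_i}\}$ where $\{rt^i_k\mid r\ge 0\}$, $k=1,\dots,n_i$, are the extreme rays of $K_i$. Let $K_i^+=K_i\cap\{z\mid d_i^\top z\ge 0\}$ and $I^+=\{i\in I\mid \mathrm{int}\,K_i^+\ne\emptyset,\ d_i\ne 0\}$. For $\eta_0>0$ and $i\in I^+$ the hyperplane $\{z\mid d_i^\top z=\eta_0\}$ intersects at least one extreme ray of $K_i$ in a single point; $\hat y^i(\eta_0)$ denotes such an intersection point (over all extreme rays of $K_i$) of minimum norm. *)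

theory Defs
  imports "HOL-Analysis.Analysis" "HOL-Probability.Probability" "HOL-Library.Set_Algebras"
begin

(* LEAST on the reals is the attained minimum, matching the "min" in the definition of phi;
   it is unspecified where the minimum does not exist. *)
definition recourse :: "real^'m^'s \<Rightarrow> real^'m \<Rightarrow> real^'s \<Rightarrow> real" where
  "recourse W q t = (LEAST c. \<exists>y. c = q \<bullet> y \<and> W *v y = t \<and> (\<forall>j. 0 \<le> y $ j))"

definition expected_excess ::
    "real^'m^'s \<Rightarrow> real^'m \<Rightarrow> (real^'s) measure \<Rightarrow> (real^'s) \<times> real \<Rightarrow> real" where
  "expected_excess W q \<mu> = (\<lambda>(x, \<eta>). LINT z|\<mu>. max 0 (recourse W q (z - x) - \<eta>))"

definition dual_feasible :: "real^'m^'s \<Rightarrow> real^'m \<Rightarrow> (real^'s) set" where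
  "dual_feasible W q = {v. \<forall>j. (transpose W *v v) $ j \<le> q $ j}"

(* The set of all d_i, i in I. The extreme points are pairwise distinct, so below they
   serve as their own indices. *)
definition dual_vertices :: "real^'m^'s \<Rightarrow> real^'m \<Rightarrow> (real^'s) set" where
  "dual_vertices W q = {d. d extreme_point_of dual_feasible W q}"

(* K_i for the vertex d = d_i *)
definition vertex_cone :: "real^'m^'s \<Rightarrow> real^'m \<Rightarrow> real^'s \<Rightarrow> (real^'s) set" where
  "vertex_cone W q d = {z. \<forall>d'\<in>dual_vertices W q. 0 \<le> (d - d') \<bullet> z}"

definition vertex_cone_pos :: "real^'m^'s \<Rightarrow> real^'m \<Rightarrow> real^'s \<Rightarrow> (real^'s) set" where
  "vertex_cone_pos W q d = vertex_cone W q d \<inter> {z. 0 \<le> d \<bullet> z}"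

(* The vertices d_i with i in I^+ *)
definition pos_vertices :: "real^'m^'s \<Rightarrow> real^'m \<Rightarrow> (real^'s) set" where
  "pos_vertices W q = {d \<in> dual_vertices W q. interior (vertex_cone_pos W q d) \<noteq> {} \<and> d \<noteq> 0}"

definition extreme_ray :: "'a::real_vector set \<Rightarrow> 'a set \<Rightarrow> bool" where
  "extreme_ray R K \<longleftrightarrow> (\<exists>t. t \<noteq> 0 \<and> R = {c *\<^sub>R t | c. 0 \<le> c}) \<and> R face_of K"

definition ray_points :: "real^'m^'s \<Rightarrow> real^'m \<Rightarrow> real^'s \<Rightarrow> real \<Rightarrow> (real^'s) set" where
  "ray_points W q d \<eta>0 =
     {y. \<exists>R. extreme_ray R (vertex_cone W q d) \<and> {z. d \<bullet> z = \<eta>0} \<inter> R = {y}}"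

(* The point y-hat^i(eta_0), for d = d_i; ties are broken arbitrarily by arg_min_on,
   which does not affect its norm. *)
definition min_ray_point :: "real^'m^'s \<Rightarrow> real^'m \<Rightarrow> real^'s \<Rightarrow> real \<Rightarrow> real^'s" where
  "min_ray_point W q d \<eta>0 = arg_min_on norm (ray_points W q d \<eta>0)"

definition partially_strongly_convex_on ::
    "('a::real_normed_vector \<times> 'b::real_vector) set \<Rightarrow> ('a \<times> 'b \<Rightarrow> real) \<Rightarrow> bool" where
  "partially_strongly_convex_on S f \<longleftrightarrow>
     (\<exists>\<kappa>>0. \<forall>(x1, \<eta>1)\<in>S. \<forall>(x2, \<eta>2)\<in>S. \<forall>l\<in>{0<..<1}.
        f (l *\<^sub>R (x1, \<eta>1) + (1 - l) *\<^sub>R (x2, \<eta>2))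
          \<le> l * f (x1, \<eta>1) + (1 - l) * f (x2, \<eta>2)
              - \<kappa> / 2 * l * (1 - l) * (norm (x1 - x2))\<^sup>2)"

end

theory Submission imports Defs begin

text \<open>
By linear programming duality the recourse function \<open>\<phi>\<close> is the support function of the dual
polyhedron, hence the maximum of the finitely many linear functions \<open>d \<bullet> t\<close> given by its vertices
(\<open>recourse_eq_dual_max\<close>, \<open>recourse_support\<close>). Positive costs put the origin into the interior of that
polyhedron, so \<open>\<phi> t \<ge> c * norm t\<close> with \<open>c > 0\<close>: the recourse function is a polyhedral gauge.

The excess \<open>max 0 (\<phi> t - \<eta>)\<close> is jointly convex in \<open>(t, \<eta>)\<close> and piecewise affine; all its curvature sits
on kinks. Strong convexity along a segment is local: it suffices to bound the second difference of
the expectation from below by \<open>\<kappa> * (e * norm x)\<^sup>2\<close> at every point of the segment, for a single arbitrarily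
small step \<open>e\<close> in direction \<open>(x, y)\<close>, with \<open>\<kappa>\<close> independent of the point and of the direction
(\<open>strong_convexity_gap\<close>). The second difference of the expectation is the \<open>\<mu>\<close>-integral of the second
difference of the excess, which is nonnegative everywhere. Around the argument in \<open>V\<close> the density is at
least \<open>r\<close> on a ball of radius \<open>\<rho>\<close>, so only the Lebesgue integral of the second difference over
\<open>ball 0 \<rho>\<close> has to be bounded from below (\<open>second_difference_ge\<close>). Two kinds of kinks do this.

For \<open>\<eta>\<close> between a small positive level and \<open>\<eta>0\<close>, the kink where the maximum with \<open>0\<close> switches on. Inside the cone of the vertex
\<open>d\<close> it is the hyperplane \<open>d \<bullet> t = \<eta>\<close>, and it contributes a multiple of \<open>(d \<bullet> x + y)\<^sup>2\<close>. Since the values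
\<open>d \<bullet> x\<close> range over an interval of length \<open>\<phi> x + \<phi> (- x) \<ge> 2 * c * norm x\<close>, some vertex satisfies
\<open>c * norm x \<le> \<bar>d \<bullet> x + y\<bar>\<close>, whatever \<open>y\<close> is (\<open>ex_vertex_speed\<close>). The hypothesis on the ray points makes
each of these hyperplane pieces at level \<open>\<eta>0\<close> meet \<open>ball 0 \<rho>\<close>; smaller levels follow by
scaling (\<open>level_ball_in_vertex_cone\<close>, \<open>cut_kink_gain\<close>).

For small or negative \<open>\<eta>\<close> these pieces shrink to the origin or vanish. There the second differences
along a line through a neighbourhood of the origin in direction \<open>x\<close> are added up; the sum telescopes to
the difference of the slopes of \<open>\<phi>\<close> at the two ends, which is bounded below by coercivity, and the
contributions of \<open>y\<close> cancel (\<open>apex_kink_gain\<close>).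

In both cases a sum of second differences over translates is bounded below, and this is turned into a
bound for the integral by counting how often a point is hit (\<open>nn_integral_ge_shift_average\<close>).
\<close>

section \<open>Linear programming duality for the recourse function\<close>

lemma dual_pairing:
  fixes W :: "real^'m^'s"
  shows "v \<bullet> (W *v y) = (transpose W *v v) \<bullet> y"
  by (simp add: dot_lmul_matrix transpose_matrix_vector)

lemma dual_feasible_iff:
  "v \<in> dual_feasible W q \<longleftrightarrow> (\<forall>j. v \<bullet> (W *v axis j 1) \<le> q $ j)"
  by (simp add: dual_feasible_def dual_pairing inner_axis)

lemma weak_duality:
  fixes W :: "real^'m^'s"
  assumes "v \<in> dual_feasible W q" "\<forall>j. 0 \<le> y $ j"
  shows "v \<bullet> (W *v y) \<le> q \<bullet> y"
proof -
  have "(transpose W *v v) \<bullet> y \<le> q \<bullet> y"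
    unfolding inner_vec_def
    using assms by (intro sum_mono) (auto simp: dual_feasible_def intro!: mult_right_mono)
  then show ?thesis by (simp add: dual_pairing)
qed

text \<open>Strong duality. The pairs \<open>(W y, q \<bullet> y + s)\<close> with \<open>y, s \<ge> 0\<close> form a finitely generated, hence closed,
convex cone. A hyperplane separating \<open>(t, v \<bullet> t)\<close> from it would, after normalisation, be a dual feasible
point better than \<open>v\<close>, or else a direction contradicting the feasibility of every right-hand side. So
\<open>v \<bullet> t\<close> is an attained primal cost.\<close>
lemma recourse_eq_dual_max:
  fixes W :: "real^'m^'s"
  assumes A1: "\<forall>t. \<exists>y. (\<forall>j. 0 \<le> y $ j) \<and> W *v y = t"
    and v: "v \<in> dual_feasible W q" and vmax: "\<And>u. u \<in> dual_feasible W q \<Longrightarrow> u \<bullet> t \<le> v \<bullet> t"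
  shows "recourse W q t = v \<bullet> t"
proof -
  let ?c = "v \<bullet> t"
  define F where "F = insert (0, 1) (range (\<lambda>j. (W *v axis j 1, q $ j)))"
  define C where "C = convex_cone hull F"
  have "finite F" by (simp add: F_def)
  have clC: "closed C" unfolding C_def by (rule closed_convex_cone_hull[OF \<open>finite F\<close>])
  have cvC: "convex C" by (simp add: C_def convex_convex_cone_hull)
  have "(t, ?c) \<in> C"
  proof (rule ccontr)
    assume "(t, ?c) \<notin> C"
    then obtain a b where ab: "a \<bullet> (t, ?c) < b" "\<forall>x\<in>C. a \<bullet> x > b"
      using separating_hyperplane_closed_point[OF cvC clC] by blast
    have b0: "b < 0"
      using ab(2) convex_cone_hull_contains_0[of F] by (force simp: C_def)
    have pos: "a \<bullet> x \<ge> 0" if "x \<in> C" for x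
    proof (rule ccontr)
      assume "\<not> a \<bullet> x \<ge> 0"
      then have n: "a \<bullet> x < 0" by simp
      have "(b / (a \<bullet> x)) *\<^sub>R x \<in> C"
        using that n b0 by (auto simp: C_def intro!: convex_cone_hull_mul divide_nonpos_nonpos)
      from bspec[OF ab(2) this] n show False by (simp add: inner_scaleR_right)
    qed
    obtain u \<beta> where a: "a = (- u, \<beta>)" by (cases a) (metis minus_minus)
    have \<beta>: "\<beta> \<ge> 0"
      using pos[of "(0,1)"] hull_subset[of F convex_cone] by (auto simp: C_def F_def a)
    have gen: "u \<bullet> (W *v axis j 1) \<le> \<beta> * q $ j" for j
      using pos[of "(W *v axis j 1, q $ j)"] hull_subset[of F convex_cone]
      by (auto simp: C_def F_def a)
    have sep: "u \<bullet> t > \<beta> * ?c" using ab(1) b0 by (simp add: a)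
    show False
    \<comment> \<open>A vertical hyperplane contradicts complete recourse; any other one rescales to a dual point.\<close>
    proof (cases "\<beta> = 0")
      case True
      have "u \<in> dual_feasible W 0" using gen True by (simp add: dual_feasible_iff)
      moreover obtain y where "\<forall>j. 0 \<le> y $ j" "W *v y = t" using A1 by blast
      ultimately show False using weak_duality[of u W 0 y] sep True by simp
    next
      case False
      then have "\<beta> > 0" using \<beta> by simp
      then have "(1 / \<beta>) *\<^sub>R u \<in> dual_feasible W q"
        using gen by (simp add: dual_feasible_iff field_simps)
      from vmax[OF this] sep \<open>\<beta> > 0\<close> show False by (simp add: field_simps)
    qed
  qed
  moreover have "C \<subseteq> {(W *v y, q \<bullet> y + r) | y r. (\<forall>j. 0 \<le> y $ j) \<and> 0 \<le> r}" (is "_ \<subseteq> ?P")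
    unfolding C_def
  proof (rule hull_minimal)
    show "F \<subseteq> ?P"
    proof -
      have "(0, 1) = (W *v 0, q \<bullet> 0 + 1)" "\<forall>j. 0 \<le> (0 :: real^'m) $ j" by auto
      then have "(0, 1) \<in> ?P" using zero_le_one by blast
      moreover have "(W *v axis j 1, q $ j) \<in> ?P" for j
      proof -
        have "(W *v axis j 1, q $ j) = (W *v axis j 1, q \<bullet> axis j 1 + 0)"
          by (simp add: inner_axis)
        moreover have "\<forall>k. 0 \<le> (axis j 1 :: real^'m) $ k" by (simp add: axis_def)
        ultimately show ?thesis by blast
      qed
      ultimately show ?thesis by (auto simp: F_def)
    qed
    have add: "x + y \<in> ?P" if xy: "x \<in> ?P" "y \<in> ?P" for x y
    proof -
      obtain y1 r1 y2 r2 where *: "x = (W *v y1, q \<bullet> y1 + r1)" "\<forall>j. 0 \<le> y1 $ j" "0 \<le> r1"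
         "y = (W *v y2, q \<bullet> y2 + r2)" "\<forall>j. 0 \<le> y2 $ j" "0 \<le> r2" using xy by blast
      have "x + y = (W *v (y1 + y2), q \<bullet> (y1 + y2) + (r1 + r2))"
        by (simp add: * matrix_vector_right_distrib inner_add_right)
      moreover have "\<forall>j. 0 \<le> (y1 + y2) $ j" "0 \<le> r1 + r2" using * by auto
      ultimately show ?thesis by blast
    qed
    have scale: "c *\<^sub>R x \<in> ?P" if x: "x \<in> ?P" and "c \<ge> 0" for x c
    proof -
      obtain y1 r1 where *: "x = (W *v y1, q \<bullet> y1 + r1)" "\<forall>j. 0 \<le> y1 $ j" "0 \<le> r1"
        using x by blast
      have "c *\<^sub>R x = (W *v (c *\<^sub>R y1), q \<bullet> (c *\<^sub>R y1) + (c * r1))"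
        by (simp add: * matrix_vector_mult_scaleR algebra_simps)
      moreover have "\<forall>j. 0 \<le> (c *\<^sub>R y1) $ j" "0 \<le> c * r1" using * \<open>c \<ge> 0\<close> by auto
      ultimately show ?thesis by blast
    qed
    have "0 = (W *v 0, q \<bullet> 0 + 0)" "\<forall>j. 0 \<le> (0 :: real^'m) $ j" by (auto simp: zero_prod_def)
    then have "0 \<in> ?P" by blast
    then show "convex_cone ?P"
      unfolding convex_cone_iff using add scale by blast
  qed
  ultimately obtain y r where y: "t = W *v y" "?c = q \<bullet> y + r" "\<forall>j. 0 \<le> y $ j" "0 \<le> r"
    by blast
  have lower: "?c \<le> q \<bullet> y'" if "\<forall>j. 0 \<le> y' $ j" "W *v y' = t" for y'
    using weak_duality[OF v that(1)] that(2) by simp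
  have "q \<bullet> y = ?c" using lower[of y] y by auto
  then show ?thesis
    unfolding recourse_def using y lower by (intro Least_equality) (auto intro!: exI[of _ y])
qed

lemma polyhedron_dual_feasible: "polyhedron (dual_feasible W q)"
proof -
  have "dual_feasible W q = (\<Inter>j. {v. (W *v axis j 1) \<bullet> v \<le> q $ j})"
    by (auto simp: dual_feasible_iff inner_commute)
  then show ?thesis by (auto simp: polyhedron_halfspace_le)
qed

text \<open>Primal feasibility of \<open>t\<close> bounds \<open>v \<bullet> t\<close> by weak duality; the right-hand sides \<open>\<plusminus>i\<close> for basis vectors
\<open>i\<close> then bound \<open>v\<close> itself.\<close>
lemma bounded_dual_feasible:
  fixes W :: "real^'m^'s"
  assumes A1: "\<forall>t. \<exists>y. (\<forall>j. 0 \<le> y $ j) \<and> W *v y = t"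
  shows "bounded (dual_feasible W q)"
proof -
  have "\<exists>b. \<forall>v\<in>dual_feasible W q. v \<bullet> t \<le> b" for t
    using A1 weak_duality[of _ W q] by metis
  then obtain b where b: "\<And>t v. v \<in> dual_feasible W q \<Longrightarrow> v \<bullet> t \<le> b t" by metis
  have "norm v \<le> (\<Sum>i\<in>Basis. max (b i) (b (- i)))" if "v \<in> dual_feasible W q" for v
  proof -
    have "norm v \<le> (\<Sum>i\<in>Basis. \<bar>v \<bullet> i\<bar>)" by (rule norm_le_l1)
    also have "\<dots> \<le> (\<Sum>i\<in>Basis. max (b i) (b (- i)))"
    proof (rule sum_mono)
      fix i :: "real^'s"
      show "\<bar>v \<bullet> i\<bar> \<le> max (b i) (b (- i))" using b[OF that, of i] b[OF that, of "- i"] by auto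
    qed
    finally show ?thesis .
  qed
  then show ?thesis unfolding bounded_iff by blast
qed

lemma zero_interior_dual_feasible:
  fixes W :: "real^'m^'s"
  assumes "\<forall>j. q $ j > 0"
  shows "0 \<in> interior (dual_feasible W q)"
proof (rule interiorI)
  let ?U = "\<Inter>j. {v. v \<bullet> (W *v axis j 1) < q $ j}"
  show "open ?U"
    by (intro open_INT ballI finite_class.finite_UNIV open_Collect_less continuous_intros)
  show "0 \<in> ?U" using assms by simp
  show "?U \<subseteq> dual_feasible W q" by (auto simp: dual_feasible_iff less_imp_le)
qed

text \<open>The dual polyhedron is compact, so it is the convex hull of its vertices and every linear function
attains its maximum over it at one of them. The coercivity constant is the radius of a ball around the
origin inside the polyhedron.\<close>
lemma recourse_support:
  fixes W :: "real^'m^'s"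
  assumes A1: "\<forall>t. \<exists>y. (\<forall>j. 0 \<le> y $ j) \<and> W *v y = t" and A6: "\<forall>j. q $ j > 0"
  shows "finite (dual_vertices W q)"
    and "\<And>d t. d \<in> dual_vertices W q \<Longrightarrow> d \<bullet> t \<le> recourse W q t"
    and "\<And>t. \<exists>d\<in>dual_vertices W q. recourse W q t = d \<bullet> t"
    and "\<exists>c>0. \<forall>t. c * norm t \<le> recourse W q t"
    and "dual_feasible W q = convex hull dual_vertices W q"
proof -
  let ?D = "dual_feasible W q" and ?E = "dual_vertices W q"
  show fin: "finite ?E"
    using finite_polyhedron_extreme_points[OF polyhedron_dual_feasible] by (simp add: dual_vertices_def)
  have cD: "compact ?D" "convex ?D"
    using polyhedron_dual_feasible polyhedron_imp_closed polyhedron_imp_convex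
      bounded_dual_feasible[OF A1] compact_eq_bounded_closed by blast+
  show hull: "?D = convex hull ?E"
    using Krein_Milman_Minkowski[OF cD] by (simp add: dual_vertices_def)
  have z: "0 \<in> interior ?D" by (rule zero_interior_dual_feasible[OF A6])
  then have "?E \<noteq> {}" using hull interior_subset by fastforce
  have ex: "\<exists>d\<in>?E. \<forall>u\<in>?D. u \<bullet> t \<le> d \<bullet> t" for t
  proof -
    obtain d where d: "d \<in> ?E" "\<And>u. u \<in> ?E \<Longrightarrow> u \<bullet> t \<le> d \<bullet> t"
      using continuous_attains_sup[OF finite_imp_compact[OF fin] \<open>?E \<noteq> {}\<close>, of "\<lambda>u. u \<bullet> t"]
        continuous_on_inner[OF continuous_on_id continuous_on_const]
      by blast
    have "convex hull ?E \<subseteq> {u. t \<bullet> u \<le> d \<bullet> t}"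
      using d(2) by (intro hull_minimal convex_halfspace_le) (auto simp: inner_commute)
    then show ?thesis using d(1) hull by (auto simp: inner_commute)
  qed
  have ED: "?E \<subseteq> ?D" by (auto simp: dual_vertices_def extreme_point_of_def)
  have ex2: "\<exists>d\<in>?E. recourse W q t = d \<bullet> t \<and> (\<forall>u\<in>?D. u \<bullet> t \<le> recourse W q t)" for t
  proof -
    obtain d where "d \<in> ?E" "\<forall>u\<in>?D. u \<bullet> t \<le> d \<bullet> t" using ex by blast
    moreover have "recourse W q t = d \<bullet> t"
      using calculation ED by (intro recourse_eq_dual_max[OF A1]) auto
    ultimately show ?thesis by auto
  qed
  show "\<And>d t. d \<in> ?E \<Longrightarrow> d \<bullet> t \<le> recourse W q t" using ex2 ED by blast
  show "\<And>t. \<exists>d\<in>?E. recourse W q t = d \<bullet> t" using ex2 by blast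
  obtain e where e: "e > 0" "cball 0 e \<subseteq> ?D" using z mem_interior_cball by blast
  have "e * norm t \<le> recourse W q t" for t
  proof (cases "t = 0")
    case True
    obtain d where "recourse W q t = d \<bullet> t" using ex2 by blast
    then show ?thesis using True by simp
  next
    case False
    have "(e / norm t) *\<^sub>R t \<in> ?D" using e False by (intro subsetD[OF e(2)]) simp
    then have "((e / norm t) *\<^sub>R t) \<bullet> t \<le> recourse W q t" using ex2 by blast
    then show ?thesis using False by (simp add: dot_square_norm power2_eq_square)
  qed
  then show "\<exists>c>0. \<forall>t. c * norm t \<le> recourse W q t" using e(1) by blast
qed

section \<open>Vertex cones and their extreme rays\<close>

lemma polyhedron_vertex_cone:
  assumes "finite (dual_vertices W q)"
  shows "polyhedron (vertex_cone W q d)"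
proof -
  have "vertex_cone W q d = (\<Inter>d'\<in>dual_vertices W q. {z. 0 \<le> (d - d') \<bullet> z})"
    by (auto simp: vertex_cone_def)
  then show ?thesis using assms by (auto simp: polyhedron_halfspace_ge)
qed

text \<open>A vertex is not in the convex hull of the remaining vertices, which is compact, so a hyperplane
separates it strictly.\<close>
lemma vertex_strictly_exposed:
  fixes W :: "real^'m^'s"
  assumes "finite (dual_vertices W q)" "dual_feasible W q = convex hull dual_vertices W q"
    and d: "d \<in> dual_vertices W q"
  shows "\<exists>z. \<forall>d'\<in>dual_vertices W q - {d}. d' \<bullet> z < d \<bullet> z"
proof -
  let ?E = "dual_vertices W q"
  let ?H = "convex hull (?E - {d})"
  have ext: "d extreme_point_of convex hull ?E"
    unfolding assms(2)[symmetric] using d unfolding dual_vertices_def by blast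
  have "d \<notin> ?H"
  proof
    assume "d \<in> ?H"
    then have "?E \<subseteq> ?H" using hull_subset[of "?E - {d}" convex] by auto
    then have "convex hull ?E = ?H"
      by (metis Diff_subset convex_convex_hull hull_minimal hull_mono subset_antisym)
    then show False using ext extreme_point_of_convex_hull by fastforce
  qed
  moreover have "closed ?H"
    using assms(1) by (simp add: compact_imp_closed finite_imp_compact_convex_hull)
  ultimately obtain a b where "a \<bullet> d < b" "\<forall>x\<in>?H. a \<bullet> x > b"
    using separating_hyperplane_closed_point[of ?H d] by auto
  then have "\<forall>d'\<in>?E - {d}. d' \<bullet> (- a) < d \<bullet> (- a)"
    using hull_subset[of "?E - {d}" convex] by (fastforce simp: inner_commute)
  then show ?thesis by blast
qed

lemma strictly_exposed_in_interior:
  assumes "finite (dual_vertices W q)"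
    and "\<forall>d'\<in>dual_vertices W q - {d}. d' \<bullet> z < d \<bullet> z"
  shows "z \<in> interior (vertex_cone W q d)"
proof (rule interiorI)
  let ?U = "\<Inter>d'\<in>dual_vertices W q - {d}. {x. d' \<bullet> x < d \<bullet> x}"
  show "open ?U" using assms(1) by (intro open_INT ballI open_Collect_less continuous_intros) auto
  show "z \<in> ?U" using assms(2) by auto
  show "?U \<subseteq> vertex_cone W q d"
  proof
    fix x assume x: "x \<in> ?U"
    have "d' \<bullet> x \<le> d \<bullet> x" if "d' \<in> dual_vertices W q" for d'
      using x that by (cases "d' = d") (auto simp: less_imp_le)
    then show "x \<in> vertex_cone W q d" by (simp add: vertex_cone_def inner_diff_left)
  qed
qed

text \<open>If \<open>d\<close> is positive on the cone off the origin, the slice \<open>d \<bullet> z = \<eta>\<close> meets every ray of the cone once.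
A segment through a point of the ray is projected radially to a segment of the slice through \<open>p\<close>, which
collapses because \<open>p\<close> is extreme.\<close>
lemma ray_through_extreme_point:
  fixes K :: "'a::real_inner set"
  assumes K: "convex K" "\<And>z c. z \<in> K \<Longrightarrow> 0 \<le> c \<Longrightarrow> c *\<^sub>R z \<in> K"
    and pos: "\<And>z. z \<in> K \<Longrightarrow> z \<noteq> 0 \<Longrightarrow> 0 < d \<bullet> z"
    and "\<eta> > 0" and p: "p extreme_point_of (K \<inter> {z. d \<bullet> z = \<eta>})"
  shows "{c *\<^sub>R p | c. 0 \<le> c} face_of K"
proof -
  let ?R = "{c *\<^sub>R p | c. 0 \<le> c}" and ?P = "K \<inter> {z. d \<bullet> z = \<eta>}"
  have pP: "p \<in> K" "d \<bullet> p = \<eta>" using p by (auto simp: extreme_point_of_def)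
  have Rc: "convex ?R"
  proof (rule convexI)
    fix x y and u v :: real assume "x \<in> ?R" "y \<in> ?R" "0 \<le> u" "0 \<le> v" "u + v = 1"
    then obtain c c' where "x = c *\<^sub>R p" "y = c' *\<^sub>R p" "0 \<le> c" "0 \<le> c'" by auto
    then have "u *\<^sub>R x + v *\<^sub>R y = (u * c + v * c') *\<^sub>R p" "0 \<le> u * c + v * c'"
      using \<open>0 \<le> u\<close> \<open>0 \<le> v\<close> by (auto simp: scaleR_left_distrib)
    then show "u *\<^sub>R x + v *\<^sub>R y \<in> ?R" by blast
  qed
  have nonneg: "0 \<le> d \<bullet> z" if "z \<in> K" for z using pos[OF that] by (cases "z = 0") auto
  have stay: "a \<in> ?R \<and> b \<in> ?R" if ab: "a \<in> K" "b \<in> K" "x \<in> ?R" "x \<in> open_segment a b" for a b x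
  proof -
    obtain u where u: "a \<noteq> b" "0 < u" "u < 1" and x: "x = (1 - u) *\<^sub>R a + u *\<^sub>R b"
      using ab(4) by (auto simp: in_segment)
    obtain c where c: "x = c *\<^sub>R p" "0 \<le> c" using ab(3) by auto
    have dx: "c * \<eta> = (1 - u) * (d \<bullet> a) + u * (d \<bullet> b)"
      using c x pP(2) by (metis inner_add_right inner_scaleR_right)
    have R0: "0 \<in> ?R" by (auto intro!: exI[of _ 0])
    have on_ray: "k *\<^sub>R p \<in> ?R" if "0 \<le> k" for k using that by auto
    consider "a = 0" | "b = 0" | "a \<noteq> 0" "b \<noteq> 0" by blast
    then show ?thesis
    proof cases
      case 1
      then have "u *\<^sub>R b = c *\<^sub>R p" using x c by simp
      then have "(1 / u) *\<^sub>R (u *\<^sub>R b) = (1 / u) *\<^sub>R (c *\<^sub>R p)" by simp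
      then have "b = (c / u) *\<^sub>R p" using u by simp
      then show ?thesis using 1 R0 on_ray[of "c / u"] c u by simp
    next
      case 2
      then have "(1 - u) *\<^sub>R a = c *\<^sub>R p" using x c by simp
      then have "(1 / (1 - u)) *\<^sub>R ((1 - u) *\<^sub>R a) = (1 / (1 - u)) *\<^sub>R (c *\<^sub>R p)" by simp
      then have "a = (c / (1 - u)) *\<^sub>R p" using u by simp
      then show ?thesis using 2 R0 on_ray[of "c / (1 - u)"] c u by simp
    next
      case 3
      then have da: "0 < d \<bullet> a" and db: "0 < d \<bullet> b" using pos ab by auto
      define a' where "a' = (\<eta> / (d \<bullet> a)) *\<^sub>R a"
      define b' where "b' = (\<eta> / (d \<bullet> b)) *\<^sub>R b"
      have aP: "a' \<in> ?P" "b' \<in> ?P"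
        using ab K(2) da db \<open>\<eta> > 0\<close> by (auto simp: a'_def b'_def)
      have "0 < c * \<eta>" using dx da db u by (simp add: add_pos_pos)
      then have c0: "c > 0" using \<open>\<eta> > 0\<close> by (simp add: zero_less_mult_iff)
      define w where "w = u * (d \<bullet> b) / (c * \<eta>)"
      have w: "0 < w" "1 - w = (1 - u) * (d \<bullet> a) / (c * \<eta>)"
        using dx da db u c0 \<open>\<eta> > 0\<close> by (auto simp: w_def field_simps)
      moreover have "0 < (1 - u) * (d \<bullet> a) / (c * \<eta>)" using da u c0 \<open>\<eta> > 0\<close> by simp
      ultimately have w1: "0 < 1 - w" by simp
      have "(1 - w) *\<^sub>R a' + w *\<^sub>R b' = (1 / c) *\<^sub>R ((1 - u) *\<^sub>R a + u *\<^sub>R b)"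
        unfolding w(2) using da db c0 \<open>\<eta> > 0\<close>
        by (simp add: a'_def b'_def w_def scaleR_right_distrib)
      also have "\<dots> = p" using x[symmetric] c c0 by simp
      finally have pw: "p = (1 - w) *\<^sub>R a' + w *\<^sub>R b'" by simp
      have "a' = b'"
      proof (rule ccontr)
        assume "a' \<noteq> b'"
        then have "p \<in> open_segment a' b'" using pw w(1) w1 by (auto simp: in_segment)
        then show False using p aP by (auto simp: extreme_point_of_def)
      qed
      then have "a' = p" "b' = p" using pw by (auto simp: scaleR_left_distrib[symmetric])
      moreover have "a = ((d \<bullet> a) / \<eta>) *\<^sub>R a'" "b = ((d \<bullet> b) / \<eta>) *\<^sub>R b'"
        using da db \<open>\<eta> > 0\<close> by (simp_all add: a'_def b'_def)
      ultimately have "a = ((d \<bullet> a) / \<eta>) *\<^sub>R p" "b = ((d \<bullet> b) / \<eta>) *\<^sub>R p"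
        by simp_all
      then show ?thesis using on_ray[of "(d \<bullet> a) / \<eta>"] on_ray[of "(d \<bullet> b) / \<eta>"] da db \<open>\<eta> > 0\<close>
        by simp
    qed
  qed
  have "?R \<subseteq> K" using K(2) pP by auto
  then show ?thesis
    unfolding face_of_def using Rc stay by blast
qed

text \<open>With positive costs the sign condition and the condition \<open>d \<noteq> 0\<close> hold for every vertex, since \<open>\<phi> \<ge> 0\<close>
and the origin is interior to the dual polyhedron.\<close>
lemma pos_vertices_eq:
  fixes W :: "real^'m^'s"
  assumes A1: "\<forall>t. \<exists>y. (\<forall>j. 0 \<le> y $ j) \<and> W *v y = t" and A6: "\<forall>j. q $ j > 0"
  shows "pos_vertices W q = dual_vertices W q"
proof -
  note S = recourse_support[OF A1 A6]
  obtain c where c: "c > 0" "\<And>t. c * norm t \<le> recourse W q t" using S(4) by blast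
  have cone: "vertex_cone_pos W q d = vertex_cone W q d" if "d \<in> dual_vertices W q" for d
  proof -
    have "0 \<le> d \<bullet> z" if "z \<in> vertex_cone W q d" for z
    proof -
      obtain d' where "d' \<in> dual_vertices W q" "recourse W q z = d' \<bullet> z" using S(3) by blast
      moreover have "0 \<le> recourse W q z" using c(1) c(2)[of z] by (simp add: order_trans[rotated])
      ultimately show ?thesis using that by (force simp: vertex_cone_def inner_diff_left)
    qed
    then show ?thesis by (auto simp: vertex_cone_pos_def)
  qed
  have "interior (vertex_cone W q d) \<noteq> {}" if "d \<in> dual_vertices W q" for d
    using strictly_exposed_in_interior[OF S(1)] vertex_strictly_exposed[OF S(1) S(5) that] by blast
  moreover have "d \<noteq> 0" if "d \<in> dual_vertices W q" for d
    using zero_interior_dual_feasible[OF A6, of W] that extreme_point_not_in_interior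
    by (auto simp: dual_vertices_def)
  ultimately show ?thesis using cone by (auto simp: pos_vertices_def)
qed

text \<open>The minimum over the ray points is meaningful only because there are finitely many of them and at
least one: a polyhedron has finitely many faces, and the compact slice of the cone has an extreme point,
which spans an extreme ray.\<close>
lemma min_ray_point_in_vertex_cone:
  fixes W :: "real^'m^'s"
  assumes A1: "\<forall>t. \<exists>y. (\<forall>j. 0 \<le> y $ j) \<and> W *v y = t" and A6: "\<forall>j. q $ j > 0"
    and "\<eta>0 > 0" and d: "d \<in> dual_vertices W q"
  shows "min_ray_point W q d \<eta>0 \<in> vertex_cone W q d \<and> d \<bullet> min_ray_point W q d \<eta>0 = \<eta>0"
proof -
  note S = recourse_support[OF A1 A6]
  let ?K = "vertex_cone W q d" and ?Y = "ray_points W q d \<eta>0"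
  obtain c where c: "c > 0" "\<And>t. c * norm t \<le> recourse W q t" using S(4) by blast
  have poly: "polyhedron ?K" by (rule polyhedron_vertex_cone[OF S(1)])
  have scale: "k *\<^sub>R z \<in> ?K" if "z \<in> ?K" "0 \<le> k" for z k
    using that by (auto simp: vertex_cone_def)
  have lower: "c * norm z \<le> d \<bullet> z" if "z \<in> ?K" for z
  proof -
    obtain d' where "d' \<in> dual_vertices W q" "recourse W q z = d' \<bullet> z" using S(3) by blast
    then show ?thesis using that c(2)[of z] by (force simp: vertex_cone_def inner_diff_left)
  qed
  then have pos: "0 < d \<bullet> z" if "z \<in> ?K" "z \<noteq> 0" for z
    using that c(1) lower[of z] by (smt (verit) mult_pos_pos zero_less_norm_iff)
  let ?P = "?K \<inter> {z. d \<bullet> z = \<eta>0}"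
  have "compact ?P"
  proof -
    have "norm z \<le> \<eta>0 / c" if "z \<in> ?P" for z
      using lower[of z] that c(1) by (auto simp: field_simps)
    then have "bounded ?P" unfolding bounded_iff by blast
    moreover have "closed ?P"
      using polyhedron_imp_closed[OF poly] by (intro closed_Int closed_hyperplane)
    ultimately show ?thesis by (simp add: compact_eq_bounded_closed)
  qed
  moreover have "convex ?P"
    using polyhedron_imp_convex[OF poly] by (intro convex_Int convex_hyperplane)
  moreover have "?P \<noteq> {}"
  proof -
    have "interior ?K \<noteq> {}"
      using strictly_exposed_in_interior[OF S(1)] vertex_strictly_exposed[OF S(1) S(5) d] by blast
    then have "\<not> ?K \<subseteq> {0}" using interior_mono[of ?K "{0}"] by auto
    then obtain z where z: "z \<in> ?K" "z \<noteq> 0" by auto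
    then have "(\<eta>0 / (d \<bullet> z)) *\<^sub>R z \<in> ?P" using pos[OF z] scale[OF z(1)] \<open>\<eta>0 > 0\<close> by simp
    then show ?thesis by blast
  qed
  ultimately obtain p where p: "p extreme_point_of ?P" by (rule extreme_point_exists_convex)
  let ?R = "{k *\<^sub>R p | k. 0 \<le> k}"
  have pP: "p \<in> ?K" "d \<bullet> p = \<eta>0" using p by (auto simp: extreme_point_of_def)
  have "?R face_of ?K"
    using polyhedron_imp_convex[OF poly] scale pos \<open>\<eta>0 > 0\<close> p by (rule ray_through_extreme_point)
  moreover have "p \<noteq> 0" using pP \<open>\<eta>0 > 0\<close> by auto
  moreover have "{z. d \<bullet> z = \<eta>0} \<inter> ?R = {p}"
    using pP \<open>\<eta>0 > 0\<close> by (auto intro!: exI[of _ 1])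
  ultimately have "p \<in> ?Y" unfolding ray_points_def extreme_ray_def by blast
  then have "?Y \<noteq> {}" by blast
  moreover have "finite ?Y"
  proof (rule finite_subset)
    show "?Y \<subseteq> (\<lambda>R. the_elem ({z. d \<bullet> z = \<eta>0} \<inter> R)) ` {R. R face_of ?K}"
    proof
      fix y assume "y \<in> ?Y"
      then obtain R where R: "R face_of ?K" "{z. d \<bullet> z = \<eta>0} \<inter> R = {y}"
        unfolding ray_points_def extreme_ray_def by blast
      have "y = the_elem ({z. d \<bullet> z = \<eta>0} \<inter> R)" unfolding R(2) by simp
      then show "y \<in> (\<lambda>R. the_elem ({z. d \<bullet> z = \<eta>0} \<inter> R)) ` {R. R face_of ?K}" using R(1) by blast
    qed
    show "finite ((\<lambda>R. the_elem ({z. d \<bullet> z = \<eta>0} \<inter> R)) ` {R. R face_of ?K})"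
      by (intro finite_imageI finite_polyhedron_faces poly)
  qed
  ultimately have "min_ray_point W q d \<eta>0 \<in> ?Y"
    unfolding min_ray_point_def by (intro arg_min_if_finite)
  then obtain R where R: "R face_of ?K" "{z. d \<bullet> z = \<eta>0} \<inter> R = {min_ray_point W q d \<eta>0}"
    by (auto simp: ray_points_def extreme_ray_def)
  then have "min_ray_point W q d \<eta>0 \<in> {z. d \<bullet> z = \<eta>0} \<inter> R" by simp
  then show ?thesis using face_of_imp_subset[OF R(1)] by blast
qed

text \<open>Moving the minimal ray point along the level hyperplane slightly into the interior of the cone
keeps its norm below \<open>\<rho>\<close> and makes room for a ball.\<close>
lemma level_ball_in_vertex_cone:
  fixes W :: "real^'m^'s"
  assumes A1: "\<forall>t. \<exists>y. (\<forall>j. 0 \<le> y $ j) \<and> W *v y = t" and A6: "\<forall>j. q $ j > 0"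
    and "\<eta>0 > 0" and d: "d \<in> dual_vertices W q" and lt: "norm (min_ray_point W q d \<eta>0) < \<rho>"
  shows "\<exists>p \<tau>. 0 < \<tau> \<and> d \<bullet> p = \<eta>0 \<and> ball p \<tau> \<subseteq> vertex_cone W q d \<inter> ball 0 \<rho>"
proof -
  note S = recourse_support[OF A1 A6]
  let ?K = "vertex_cone W q d" and ?y = "min_ray_point W q d \<eta>0"
  have y: "?y \<in> ?K" "d \<bullet> ?y = \<eta>0" using min_ray_point_in_vertex_cone[OF A1 A6 \<open>\<eta>0 > 0\<close> d] by auto
  obtain z0 where z0: "\<forall>d'\<in>dual_vertices W q - {d}. d' \<bullet> z0 < d \<bullet> z0"
    using vertex_strictly_exposed[OF S(1) S(5) d] by blast
  \<comment> \<open>The direction is tangent to the level set: the multiple of the ray point restores the level.\<close>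
  define k where "k = (\<lambda>u. ?y + u *\<^sub>R (z0 - ((d \<bullet> z0) / \<eta>0) *\<^sub>R ?y))"
  have "(k \<longlongrightarrow> ?y + 0 *\<^sub>R (z0 - ((d \<bullet> z0) / \<eta>0) *\<^sub>R ?y)) (at_right 0)"
    unfolding k_def by (intro tendsto_intros)
  then have "(k \<longlongrightarrow> ?y) (at_right 0)" by simp
  then have "\<forall>\<^sub>F u in at_right 0. norm (k u) < \<rho>"
    using lt by (intro order_tendstoD(2)[OF tendsto_norm])
  moreover have "\<forall>\<^sub>F u in at_right 0. 1 - u * ((d \<bullet> z0) / \<eta>0) > 0"
    by (rule order_tendstoD(1)[of _ "1 - 0 * ((d \<bullet> z0) / \<eta>0)"]) (intro tendsto_intros, simp)
  moreover have "\<forall>\<^sub>F u in at_right (0::real). u > 0" by (rule eventually_at_right_less)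
  ultimately have "\<forall>\<^sub>F u in at_right 0. norm (k u) < \<rho> \<and> 1 - u * ((d \<bullet> z0) / \<eta>0) > 0 \<and> u > 0"
    by eventually_elim simp
  then obtain u where u: "norm (k u) < \<rho>" "1 - u * ((d \<bullet> z0) / \<eta>0) > 0" "u > 0"
    using eventually_happens' trivial_limit_at_right_real by blast
  have ku: "k u = (1 - u * ((d \<bullet> z0) / \<eta>0)) *\<^sub>R ?y + u *\<^sub>R z0"
    by (simp add: k_def algebra_simps)
  have "d \<bullet> k u = \<eta>0" using y \<open>\<eta>0 > 0\<close> by (simp add: k_def inner_simps)
  have "d' \<bullet> k u < d \<bullet> k u" if d': "d' \<in> dual_vertices W q - {d}" for d'
  proof -
    have "(1 - u * ((d \<bullet> z0) / \<eta>0)) * (d' \<bullet> ?y) \<le> (1 - u * ((d \<bullet> z0) / \<eta>0)) * (d \<bullet> ?y)"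
      using y(1) d' u(2) by (intro mult_left_mono) (auto simp: vertex_cone_def inner_diff_left)
    moreover have "u * (d' \<bullet> z0) < u * (d \<bullet> z0)" using z0 d' u by simp
    ultimately show ?thesis unfolding ku inner_add_right inner_scaleR_right by linarith
  qed
  then have "k u \<in> interior ?K" using strictly_exposed_in_interior[OF S(1)] by blast
  then have "k u \<in> interior (?K \<inter> ball 0 \<rho>)" using u(1) by simp
  then obtain \<tau> where "0 < \<tau>" "ball (k u) \<tau> \<subseteq> ?K \<inter> ball 0 \<rho>" using mem_interior by blast
  then show ?thesis using \<open>d \<bullet> k u = \<eta>0\<close> by blast
qed

section \<open>Strong convexity on the unit interval from second differences\<close>

text \<open>Subtract from \<open>h\<close> its chord and add the quadratic gap. If the claim failed, the resulting function,
which vanishes at both end points, would have an interior maximum; there no second difference can be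
positive.\<close>
lemma strong_convexity_gap:
  fixes h :: "real \<Rightarrow> real"
  assumes cont: "continuous_on {0..1} h"
    and sd: "\<And>t. 0 < t \<Longrightarrow> t < 1 \<Longrightarrow>
      \<exists>e>0. e \<le> t \<and> e \<le> 1 - t \<and> \<kappa> * e\<^sup>2 < h (t + e) + h (t - e) - 2 * h t"
    and l: "0 < l" "l < 1"
  shows "h l \<le> l * h 1 + (1 - l) * h 0 - \<kappa> / 2 * l * (1 - l)"
proof (rule ccontr)
  assume gap: "\<not> ?thesis"
  define k where "k = (\<lambda>t. h t - (t * h 1 + (1 - t) * h 0 - \<kappa> / 2 * t * (1 - t)))"
  have "k l > 0" using gap by (simp add: k_def)
  have "continuous_on {0..1} k" unfolding k_def by (intro continuous_intros cont)
  then obtain t where t: "t \<in> {0..1}" "\<And>s. s \<in> {0..1} \<Longrightarrow> k s \<le> k t"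
    using continuous_attains_sup[of "{0..1}" k] by auto
  have "k t > 0" using t(2)[of l] l \<open>k l > 0\<close> by simp
  moreover have "k 0 = 0" "k 1 = 0" by (simp_all add: k_def)
  ultimately have "t \<noteq> 0" "t \<noteq> 1" by auto
  then have "0 < t" "t < 1" using t(1) by auto
  then obtain e where e: "0 < e" "e \<le> t" "e \<le> 1 - t"
      "\<kappa> * e\<^sup>2 < h (t + e) + h (t - e) - 2 * h t" using sd by blast
  have "k (t + e) + k (t - e) - 2 * k t = h (t + e) + h (t - e) - 2 * h t - \<kappa> * e\<^sup>2"
    by (simp add: k_def power2_eq_square field_simps)
  moreover have "k (t + e) \<le> k t" "k (t - e) \<le> k t" using e t(1) by (auto intro!: t(2))
  ultimately show False using e(4) by linarith
qed

section \<open>Averaging a lower bound over translates\<close>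

lemma nn_integral_translate:
  fixes c :: "'a::euclidean_space"
  assumes [measurable]: "f \<in> borel_measurable borel"
  shows "(\<integral>\<^sup>+t. f (c + t) \<partial>lborel) = (\<integral>\<^sup>+t. f t \<partial>lborel)"
proof -
  have "(\<integral>\<^sup>+t. f t \<partial>lborel) = (\<integral>\<^sup>+t. f t \<partial>distr lborel borel ((+) c))"
    by (simp add: lborel_distr_plus)
  also have "\<dots> = (\<integral>\<^sup>+t. f (c + t) \<partial>lborel)"
    by (rule nn_integral_distr) simp_all
  finally show ?thesis by simp
qed

text \<open>The shifts landing in the ball are spread over a distance less than \<open>2 * \<tau>\<close> along \<open>w\<close>.\<close>
lemma card_shifts_in_ball:
  fixes w :: "'a::real_normed_vector"
  assumes w: "w \<noteq> 0" "norm w \<le> \<tau>" and fin: "finite N" and N: "\<And>k. k \<in> N \<Longrightarrow> t - of_int k *\<^sub>R w \<in> ball p \<tau>"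
  shows "real (card N) \<le> 3 * \<tau> / norm w"
proof (cases "N = {}")
  case True
  then show ?thesis using w order_trans[OF norm_ge_zero w(2)] by simp
next
  case False
  let ?a = "Min N" and ?b = "Max N"
  have ab: "?a \<in> N" "?b \<in> N" "?a \<le> ?b" using fin False by auto
  have "N \<subseteq> {?a..?b}" using fin by auto
  then have "card N \<le> card {?a..?b}" by (intro card_mono) auto
  then have 1: "real (card N) \<le> of_int (?b - ?a) + 1" using ab(3) by simp
  have "of_int (?b - ?a) * norm w = norm (of_int (?b - ?a) *\<^sub>R w)" using ab(3) by simp
  also have "\<dots> = dist (t - of_int ?a *\<^sub>R w) (t - of_int ?b *\<^sub>R w)"
    by (simp add: dist_norm scaleR_diff_left)
  also have "\<dots> < \<tau> + \<tau>"
    using N[OF ab(1)] N[OF ab(2)] dist_triangle_less_add[of _ p \<tau> _ \<tau>] by (simp add: dist_commute)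
  finally have "of_int (?b - ?a) + 1 \<le> (2 * \<tau> + norm w) / norm w"
    using w by (simp add: field_simps)
  also have "\<dots> \<le> 3 * \<tau> / norm w" using w by (intro divide_right_mono) auto
  finally show ?thesis using 1 by linarith
qed

text \<open>Integrate the bound on the sum over the ball and move each translate back: a point of \<open>U\<close> is then
counted at most \<open>3 * \<tau> / norm w\<close> times. With \<open>\<sigma>\<close> of order \<open>norm w\<close> this yields an integral of order
\<open>(norm w)\<^sup>2\<close> without any decomposition of the space along \<open>w\<close>.\<close>
lemma nn_integral_ge_shift_average:
  fixes S :: "'a::euclidean_space \<Rightarrow> ennreal" and w p :: 'a and n :: int
  assumes S[measurable]: "S \<in> borel_measurable borel" and U[measurable]: "U \<in> sets borel"
    and w: "w \<noteq> 0" "norm w \<le> \<tau>" and \<sigma>: "0 \<le> \<sigma>"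
    and sub: "\<And>t k. t \<in> ball p \<tau> \<Longrightarrow> \<bar>k\<bar> \<le> n \<Longrightarrow> t + of_int k *\<^sub>R w \<in> U"
    and sum: "\<And>t. t \<in> ball p \<tau> \<Longrightarrow> ennreal \<sigma> \<le> (\<Sum>k\<in>{-n..n}. S (t + of_int k *\<^sub>R w))"
  shows "ennreal (\<sigma> * measure lborel (ball p \<tau>) * norm w / (3 * \<tau>))
    \<le> (\<integral>\<^sup>+t. S t * indicator U t \<partial>lborel)" (is "_ \<le> ?I")
proof -
  let ?A = "ball p \<tau>"
  define M where "M = 3 * \<tau> / norm w"
  have \<tau>: "\<tau> > 0" using w by (meson less_le_trans zero_less_norm_iff)
  then have M: "M > 0" using w by (simp add: M_def)
  have [measurable]: "(\<lambda>t. indicator ?A (t - c) :: ennreal) \<in> borel_measurable borel" for c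
    by (rule measurable_compose[where N = borel and g = "indicator ?A"])
       (auto intro!: borel_measurable_indicator)
  have [measurable]: "?A \<in> sets borel" by simp
  have translate: "(\<integral>\<^sup>+t. S (t + c) * indicator ?A t \<partial>lborel)
      = (\<integral>\<^sup>+t. S t * indicator ?A (t - c) \<partial>lborel)" for c
  proof -
    have "(\<integral>\<^sup>+t. S (c + t) * indicator ?A (c + t - c) \<partial>lborel)
        = (\<integral>\<^sup>+t. S t * indicator ?A (t - c) \<partial>lborel)"
      by (rule nn_integral_translate) measurable
    then show ?thesis by (simp add: add.commute)
  qed
  have pointwise: "(\<Sum>k\<in>{-n..n}. S t * indicator ?A (t - of_int k *\<^sub>R w))
      \<le> ennreal M * (S t * indicator U t)" for t
  proof -
    let ?N = "{k \<in> {-n..n}. t - of_int k *\<^sub>R w \<in> ?A}"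
    have "(\<Sum>k\<in>{-n..n}. S t * indicator ?A (t - of_int k *\<^sub>R w)) = (\<Sum>k\<in>?N. S t)"
      by (rule sum.mono_neutral_cong_right) (auto simp: indicator_def)
    also have "\<dots> = of_nat (card ?N) * S t" by simp
    also have "\<dots> \<le> ennreal M * (S t * indicator U t)"
    proof (cases "?N = {}")
      case True
      then have "card ?N = 0" by (simp only: card.empty)
      then show ?thesis by simp
    next
      case False
      then obtain k where "k \<in> ?N" by blast
      then have "t \<in> U" using sub[of "t - of_int k *\<^sub>R w" k] by auto
      have "real (card ?N) \<le> M"
        unfolding M_def
      proof (rule card_shifts_in_ball[OF w])
        show "finite ?N" by (rule finite_subset[of _ "{-n..n}"]) auto
      qed blast
      then have "of_nat (card ?N) \<le> ennreal M"
        by (metis ennreal_leI ennreal_of_nat_eq_real_of_nat)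
      then show ?thesis using \<open>t \<in> U\<close> by (simp add: mult_right_mono)
    qed
    finally show ?thesis .
  qed
  have fin: "emeasure lborel ?A = ennreal (measure lborel ?A)"
    using emeasure_lborel_ball_finite[of p \<tau>] by (intro emeasure_eq_ennreal_measure) auto
  have "ennreal \<sigma> * emeasure lborel ?A = (\<integral>\<^sup>+t. ennreal \<sigma> * indicator ?A t \<partial>lborel)"
    by (simp add: nn_integral_cmult_indicator)
  also have "\<dots> \<le> (\<integral>\<^sup>+t. (\<Sum>k\<in>{-n..n}. S (t + of_int k *\<^sub>R w) * indicator ?A t) \<partial>lborel)"
    using sum by (intro nn_integral_mono) (auto simp: indicator_def)
  also have "\<dots> = (\<Sum>k\<in>{-n..n}. \<integral>\<^sup>+t. S (t + of_int k *\<^sub>R w) * indicator ?A t \<partial>lborel)"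
    by (rule nn_integral_sum) measurable
  also have "\<dots> = (\<Sum>k\<in>{-n..n}. \<integral>\<^sup>+t. S t * indicator ?A (t - of_int k *\<^sub>R w) \<partial>lborel)"
    by (simp add: translate)
  also have "\<dots> = (\<integral>\<^sup>+t. (\<Sum>k\<in>{-n..n}. S t * indicator ?A (t - of_int k *\<^sub>R w)) \<partial>lborel)"
    by (rule nn_integral_sum[symmetric]) measurable
  also have "\<dots> \<le> (\<integral>\<^sup>+t. ennreal M * (S t * indicator U t) \<partial>lborel)"
    by (intro nn_integral_mono pointwise)
  also have "\<dots> = ennreal M * ?I" by (rule nn_integral_cmult) measurable
  finally have "ennreal (\<sigma> * measure lborel ?A) \<le> ennreal M * ?I"
    using \<sigma> by (simp add: fin ennreal_mult)
  then have "ennreal (1 / M) * ennreal (\<sigma> * measure lborel ?A) \<le> ennreal (1 / M) * (ennreal M * ?I)"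
    by (rule mult_left_mono) simp
  also have "\<dots> = ?I" using M by (simp add: mult.assoc[symmetric] ennreal_mult[symmetric])
  finally have "ennreal ((1 / M) * (\<sigma> * measure lborel ?A)) \<le> ?I"
    using M \<sigma> by (subst ennreal_mult) auto
  moreover have "(1 / M) * (\<sigma> * measure lborel ?A) = \<sigma> * measure lborel ?A * norm w / (3 * \<tau>)"
    by (simp add: M_def)
  ultimately show ?thesis by simp
qed

lemma sum_telescope_int:
  fixes f :: "int \<Rightarrow> real"
  assumes "a \<le> b"
  shows "(\<Sum>k\<in>{a..b}. f (k + 1) - f k) = f (b + 1) - f a"
  using assms
proof (induction b rule: int_ge_induct)
  case (step i)
  have "{a..i + 1} = insert (i + 1) {a..i}" using step by auto
  then show ?case using step by simp
qed simp

lemma eventually_small_multiple: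
  fixes a B :: real
  assumes "0 < B"
  shows "\<forall>\<^sub>F e in at_right 0. e * a < B"
proof (rule order_tendstoD(2))
  show "((\<lambda>e. e * a) \<longlongrightarrow> 0 * a) (at_right 0)" by (intro tendsto_intros)
qed (use assms in simp)

section \<open>Kinks of the excess of a polyhedral gauge\<close>

text \<open>The second difference, in the step \<open>(w, \<delta>)\<close> of the decision \<open>(x, \<eta>)\<close>, of the excess as a function of
\<open>t = z - x\<close>; moving \<open>x\<close> forward moves \<open>t\<close> backward, whence the sign of \<open>w\<close>.\<close>
definition excess_kink :: "('a::real_vector \<Rightarrow> real) \<Rightarrow> real \<Rightarrow> 'a \<Rightarrow> real \<Rightarrow> 'a \<Rightarrow> real" where
  "excess_kink \<phi> \<eta> w \<delta> t =
     max 0 (\<phi> (t - w) - (\<eta> + \<delta>)) + max 0 (\<phi> (t + w) - (\<eta> - \<delta>)) - 2 * max 0 (\<phi> t - \<eta>)"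

text \<open>What the rest of the argument uses about the recourse function; \<open>E\<close> stands for the dual vertices.\<close>
locale polyhedral_gauge =
  fixes E :: "'a::euclidean_space set" and \<phi> :: "'a \<Rightarrow> real" and c :: real
  assumes finite_E: "finite E"
    and upper: "\<And>d t. d \<in> E \<Longrightarrow> d \<bullet> t \<le> \<phi> t"
    and attained: "\<And>t. \<exists>d\<in>E. \<phi> t = d \<bullet> t"
    and c_pos: "c > 0"
    and coercive: "\<And>t. c * norm t \<le> \<phi> t"
begin

lemma subadditive: "\<phi> (s + t) \<le> \<phi> s + \<phi> t"
proof -
  obtain d where "d \<in> E" "\<phi> (s + t) = d \<bullet> (s + t)" using attained by blast
  then show ?thesis using upper[of d s] upper[of d t] by (simp add: inner_add_right)
qed

lemma homogeneous:
  assumes "0 \<le> a" shows "\<phi> (a *\<^sub>R t) = a * \<phi> t"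
proof (rule antisym)
  obtain d where "d \<in> E" "\<phi> (a *\<^sub>R t) = d \<bullet> (a *\<^sub>R t)" using attained by blast
  then show "\<phi> (a *\<^sub>R t) \<le> a * \<phi> t" using upper[of d t] assms by (simp add: mult_left_mono)
  obtain d where "d \<in> E" "\<phi> t = d \<bullet> t" using attained by blast
  then show "a * \<phi> t \<le> \<phi> (a *\<^sub>R t)" using upper[of d "a *\<^sub>R t"] by simp
qed

lemma convex_gauge: "convex_on UNIV \<phi>"
proof (rule convex_onI)
  fix u :: real and s t assume "0 < u" "u < 1"
  then show "\<phi> ((1 - u) *\<^sub>R s + u *\<^sub>R t) \<le> (1 - u) * \<phi> s + u * \<phi> t"
    using subadditive[of "(1 - u) *\<^sub>R s" "u *\<^sub>R t"] by (simp add: homogeneous)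
qed simp

lemma borel_measurable_gauge [measurable]: "\<phi> \<in> borel_measurable borel"
  using convex_on_continuous[OF open_UNIV convex_gauge] by (rule borel_measurable_continuous_onI)

lemma obtain_bound:
  obtains C where "C > 0" "\<And>d. d \<in> E \<Longrightarrow> norm d \<le> C" "\<And>t. \<phi> t \<le> C * norm t"
proof
  let ?C = "1 + (\<Sum>d\<in>E. norm d)"
  show "?C > 0" by (simp add: add_pos_nonneg sum_nonneg)
  show le: "norm d \<le> ?C" if "d \<in> E" for d
    using member_le_sum[OF that, of norm] finite_E by simp
  show "\<phi> t \<le> ?C * norm t" for t
  proof -
    obtain d where "d \<in> E" "\<phi> t = d \<bullet> t" using attained by blast
    then show ?thesis using norm_cauchy_schwarz[of d t] mult_right_mono[OF le, of d "norm t"] by simp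
  qed
qed

lemma excess_midpoint:
  assumes "s + t = 2 *\<^sub>R m" "\<eta>1 + \<eta>2 = 2 * \<eta>"
  shows "2 * max 0 (\<phi> m - \<eta>) \<le> max 0 (\<phi> s - \<eta>1) + max 0 (\<phi> t - \<eta>2)"
proof -
  have "2 * \<phi> m \<le> \<phi> s + \<phi> t" using subadditive[of s t] assms homogeneous[of 2 m] by simp
  then show ?thesis using assms(2) by (auto simp: max_def)
qed

lemma excess_kink_nonneg: "0 \<le> excess_kink \<phi> \<eta> w \<delta> t"
  using excess_midpoint[of "t - w" "t + w" t "\<eta> + \<delta>" "\<eta> - \<delta>" \<eta>]
  by (simp add: excess_kink_def scaleR_2)

lemma borel_measurable_excess_kink [measurable]: "excess_kink \<phi> \<eta> w \<delta> \<in> borel_measurable borel"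
  unfolding excess_kink_def by measurable

text \<open>Where \<open>\<phi> t = d \<bullet> t\<close>, the second difference is the hat function of height \<open>b\<close> in the variable
\<open>d \<bullet> t - \<eta>\<close>. Translating by a vector \<open>v\<close> with \<open>d \<bullet> v = b\<close>, every orbit has a member at which that
variable is at most \<open>b / 2\<close> in absolute value, so the hat is at least \<open>b / 2\<close> there.\<close>
lemma cut_kink_gain:
  assumes region: "\<And>t. t \<in> ball p (5 * \<tau>) \<Longrightarrow> \<phi> t = d \<bullet> t" "ball p (5 * \<tau>) \<subseteq> ball 0 \<rho>"
    and p: "d \<bullet> p = \<eta>" and w: "norm w \<le> \<tau>"
    and b: "b = \<bar>d \<bullet> w + \<delta>\<bar>" "0 < b" "b \<le> \<tau> * norm d"
  shows "ennreal (b\<^sup>2 * measure lborel (ball p \<tau>) / (6 * \<tau> * norm d))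
    \<le> (\<integral>\<^sup>+t. ennreal (excess_kink \<phi> \<eta> w \<delta> t) * indicator (ball 0 \<rho>) t \<partial>lborel)"
proof -
  have d: "d \<noteq> 0" using b by auto
  define v where "v = (b / (norm d)\<^sup>2) *\<^sub>R d"
  \<comment> \<open>Enough shifts to reach the hyperplane from anywhere in the ball, few enough to stay in the region.\<close>
  define n where "n = \<lceil>\<tau> * norm d / b\<rceil> + 1"
  have dv: "d \<bullet> v = b" using d by (simp add: v_def dot_square_norm)
  have nv: "norm v = b / norm d" using d b by (simp add: v_def power2_eq_square)
  have "v \<noteq> 0" using d b by (auto simp: v_def)
  moreover have "norm v \<le> \<tau>" using d b(3) by (simp add: nv divide_le_eq)
  ultimately have v: "v \<noteq> 0" "norm v \<le> \<tau>" by blast+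
  have \<tau>: "\<tau> > 0" using v by (meson less_le_trans zero_less_norm_iff)
  have in_region: "t + of_int k *\<^sub>R v \<in> ball p (4 * \<tau>)" if "t \<in> ball p \<tau>" "\<bar>k\<bar> \<le> n" for t k
  proof -
    have "norm (of_int k *\<^sub>R v) \<le> (\<tau> * norm d / b + 2) * norm v"
      unfolding norm_scaleR using that(2) by (intro mult_right_mono) (auto simp: n_def, linarith)
    also have "\<dots> = \<tau> + 2 * norm v" using d b by (simp add: nv field_simps)
    also have "\<dots> \<le> 3 * \<tau>" using v by simp
    finally have "norm (of_int k *\<^sub>R v) \<le> 3 * \<tau>" .
    then have "norm ((t - p) + of_int k *\<^sub>R v) < \<tau> + 3 * \<tau>"
      using that(1) norm_triangle_ineq[of "t - p" "of_int k *\<^sub>R v"]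
      by (simp add: dist_norm norm_minus_commute)
    then show ?thesis by (simp add: dist_norm norm_minus_commute algebra_simps)
  qed
  have kink: "b / 2 \<le> excess_kink \<phi> \<eta> w \<delta> t"
    if t: "t \<in> ball p (4 * \<tau>)" and small: "\<bar>d \<bullet> t - \<eta>\<bar> \<le> b / 2" for t
  proof -
    have "t \<in> ball p (5 * \<tau>)" using t \<tau> by auto
    moreover have "t - w \<in> ball p (5 * \<tau>)" "t + w \<in> ball p (5 * \<tau>)"
      using t w norm_triangle_ineq4[of "t - p" w] norm_triangle_ineq[of "t - p" w]
      by (auto simp: dist_norm norm_minus_commute algebra_simps)
    ultimately have "excess_kink \<phi> \<eta> w \<delta> t = max 0 ((d \<bullet> t - \<eta>) - (d \<bullet> w + \<delta>))
        + max 0 ((d \<bullet> t - \<eta>) + (d \<bullet> w + \<delta>)) - 2 * max 0 (d \<bullet> t - \<eta>)"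
      by (simp add: excess_kink_def region(1) inner_simps algebra_simps)
    then show ?thesis using small b(1,2) by (auto simp: max_def abs_if split: if_splits)
  qed
  have "ennreal (b / 2 * measure lborel (ball p \<tau>) * norm v / (3 * \<tau>))
    \<le> (\<integral>\<^sup>+t. ennreal (excess_kink \<phi> \<eta> w \<delta> t) * indicator (ball 0 \<rho>) t \<partial>lborel)"
  proof (rule nn_integral_ge_shift_average[where n = n])
    show "t + of_int k *\<^sub>R v \<in> ball 0 \<rho>" if "t \<in> ball p \<tau>" "\<bar>k\<bar> \<le> n" for t k
    proof -
      have "t + of_int k *\<^sub>R v \<in> ball p (5 * \<tau>)" using in_region[OF that] \<tau> by auto
      then show ?thesis using region(2) by blast
    qed
  next
    fix t assume t: "t \<in> ball p \<tau>"
    define a where "a = (d \<bullet> t - \<eta>) / b"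
    define k where "k = - round a"
    have "\<bar>d \<bullet> t - \<eta>\<bar> \<le> norm d * \<tau>"
    proof -
      have "\<bar>d \<bullet> t - \<eta>\<bar> = \<bar>d \<bullet> (t - p)\<bar>" by (simp add: p inner_diff_right)
      also have "\<dots> \<le> norm d * norm (t - p)" by (rule Cauchy_Schwarz_ineq2)
      also have "\<dots> \<le> norm d * \<tau>"
        using t by (intro mult_left_mono) (auto simp: dist_norm norm_minus_commute)
      finally show ?thesis .
    qed
    then have abs_a: "\<bar>a\<bar> \<le> \<tau> * norm d / b" using b(2) by (simp add: a_def divide_right_mono mult.commute)
    have rd: "\<bar>of_int (round a) - a\<bar> \<le> 1 / 2" by (rule of_int_round_abs_le)
    have "of_int \<bar>k\<bar> \<le> \<tau> * norm d / b + 1" unfolding k_def using rd abs_a by linarith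
    then have kn: "\<bar>k\<bar> \<le> n" unfolding n_def by linarith
    have "\<bar>d \<bullet> (t + of_int k *\<^sub>R v) - \<eta>\<bar> = b * \<bar>of_int (round a) - a\<bar>"
    proof -
      have "d \<bullet> t - \<eta> = b * a" using b(2) by (simp add: a_def)
      moreover have "d \<bullet> (t + of_int k *\<^sub>R v) = d \<bullet> t - of_int (round a) * b"
        by (simp add: inner_add_right inner_diff_right dv k_def)
      ultimately have "d \<bullet> (t + of_int k *\<^sub>R v) - \<eta> = - (b * (of_int (round a) - a))"
        by (simp add: algebra_simps)
      then show ?thesis using b(2) by (simp only: abs_minus_cancel abs_mult abs_of_pos)
    qed
    also have "\<dots> \<le> b / 2" using rd b(2) mult_left_mono[OF rd, of b] by simp
    finally have "b / 2 \<le> excess_kink \<phi> \<eta> w \<delta> (t + of_int k *\<^sub>R v)"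
      using kink[OF in_region[OF t kn]] by simp
    then have "ennreal (b / 2) \<le> ennreal (excess_kink \<phi> \<eta> w \<delta> (t + of_int k *\<^sub>R v))"
      by (rule ennreal_leI)
    also have "\<dots> \<le> (\<Sum>k\<in>{-n..n}. ennreal (excess_kink \<phi> \<eta> w \<delta> (t + of_int k *\<^sub>R v)))"
      using kn by (intro member_le_sum) auto
    finally show "ennreal (b / 2) \<le> \<dots>" .
  qed (use v b in auto)
  also have "b / 2 * measure lborel (ball p \<tau>) * norm v / (3 * \<tau>)
      = b\<^sup>2 * measure lborel (ball p \<tau>) / (6 * \<tau> * norm d)"
    using d \<tau> by (simp add: nv power2_eq_square field_simps)
  finally show ?thesis .
qed

text \<open>The increments of a convex function along a ray increase, so the one after \<open>n\<close> steps is at least the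
average of the first \<open>n\<close>.\<close>
lemma last_increment_ge:
  assumes "1 \<le> (n :: real)"
  shows "\<phi> (t + n *\<^sub>R w) - \<phi> t \<le> n * (\<phi> (t + (n + 1) *\<^sub>R w) - \<phi> (t + n *\<^sub>R w))"
proof -
  have "(n + 1) *\<^sub>R (t + n *\<^sub>R w) = t + n *\<^sub>R (t + (n + 1) *\<^sub>R w)"
    by (simp add: algebra_simps)
  then have "(n + 1) * \<phi> (t + n *\<^sub>R w) = \<phi> (t + n *\<^sub>R (t + (n + 1) *\<^sub>R w))"
    using homogeneous[of "n + 1" "t + n *\<^sub>R w"] assms by simp
  also have "\<dots> \<le> \<phi> t + n * \<phi> (t + (n + 1) *\<^sub>R w)"
    using subadditive[of t "n *\<^sub>R (t + (n + 1) *\<^sub>R w)"] assms by (simp add: homogeneous)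
  finally show ?thesis by (simp add: algebra_simps)
qed

text \<open>For points \<open>t\<close> near the origin the second differences at \<open>t + k w\<close>, \<open>- n \<le> k \<le> n\<close>, are at least the
terms of two telescoping sums, one for each of the levels \<open>\<eta> \<plusminus> \<delta>\<close>. At the ends \<open>n * norm w\<close> is about
\<open>\<rho> / 2\<close>, so \<open>\<phi>\<close> exceeds both levels there, the levels cancel, and what remains are the last increments
of \<open>\<phi>\<close> in the directions \<open>w\<close> and \<open>- w\<close>. Each of them is of order \<open>norm w\<close>, because \<open>\<phi>\<close> climbs from
nearly \<open>0\<close> at \<open>t\<close> to at least \<open>c * \<rho> / 4\<close>.\<close>
lemma apex_kink_gain:
  assumes C: "\<And>t. \<phi> t \<le> C * norm t" "C > 0"
    and \<tau>: "0 < \<tau>" "\<tau> \<le> \<rho> / 8" "C * \<tau> \<le> c * \<rho> / 8"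
    and w: "w \<noteq> 0" "norm w \<le> \<tau>" and \<eta>: "\<eta> + \<bar>\<delta>\<bar> \<le> c * \<rho> / 4"
  shows "ennreal (c * (norm w)\<^sup>2 * measure lborel (ball (0::'a) \<tau>) / (6 * \<tau>))
    \<le> (\<integral>\<^sup>+t. ennreal (excess_kink \<phi> \<eta> w \<delta> t) * indicator (ball 0 \<rho>) t \<partial>lborel)"
proof -
  define n where "n = \<lfloor>(\<rho> / 2) / norm w\<rfloor>"
  have \<rho>: "\<rho> > 0" using \<tau> by simp
  have nw: "0 < norm w" using w by simp
  have n1: "of_int n * norm w \<le> \<rho> / 2"
    using of_int_floor_le[of "(\<rho> / 2) / norm w"] nw unfolding n_def by (simp only: pos_le_divide_eq)
  have "(\<rho> / 2) / norm w < of_int n + 1" unfolding n_def by linarith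
  then have n2: "\<rho> / 2 - norm w < of_int n * norm w" using nw by (simp add: field_simps)
  have "0 < of_int n * norm w" using n2 w \<tau> by linarith
  then have n0: "1 \<le> n" using nw by (simp add: zero_less_mult_iff)
  have far: "c * \<rho> / 4 \<le> \<phi> (t + x *\<^sub>R w)" if t: "t \<in> ball 0 \<tau>" and x: "of_int n \<le> \<bar>x\<bar>" for t x
  proof -
    have "\<rho> / 2 - norm w < \<bar>x\<bar> * norm w"
      using n2 mult_right_mono[OF x norm_ge_zero[of w]] by linarith
    then have "\<rho> / 2 - norm w - \<tau> \<le> norm (t + x *\<^sub>R w)"
      using t norm_diff_ineq[of "x *\<^sub>R w" t] by (simp add: add.commute)
    then have "\<rho> / 4 \<le> norm (t + x *\<^sub>R w)" using w \<tau> by linarith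
    then have "c * (\<rho> / 4) \<le> c * norm (t + x *\<^sub>R w)" using c_pos by simp
    then show ?thesis using coercive[of "t + x *\<^sub>R w"] by simp
  qed
  have increment: "c * norm u / 4 \<le> \<phi> (t + (of_int n + 1) *\<^sub>R u) - \<phi> (t + of_int n *\<^sub>R u)" (is "_ \<le> ?i")
    if t: "t \<in> ball 0 \<tau>" and u: "u = w \<or> u = - w" for t u
  proof -
    have "c * \<rho> / 4 \<le> \<phi> (t + of_int n *\<^sub>R u)"
      using far[OF t, of "of_int n"] far[OF t, of "- of_int n"] n0 u by auto
    moreover have "\<phi> t \<le> c * \<rho> / 8"
    proof -
      have "C * norm t \<le> C * \<tau>" using t C(2) by (intro mult_left_mono) auto
      then show ?thesis using C(1)[of t] \<tau>(3) by linarith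
    qed
    moreover have "1 \<le> real_of_int n" using n0 by simp
    ultimately have "c * \<rho> / 8 \<le> of_int n * ?i"
      using last_increment_ge[of "of_int n" t u] by linarith
    then have "c * \<rho> / 8 * norm w \<le> of_int n * ?i * norm w" by (rule mult_right_mono) simp
    also have "\<dots> = (of_int n * norm w) * ?i" by simp
    also have "\<dots> \<le> \<rho> / 2 * ?i"
    proof (rule mult_right_mono[OF n1])
      have "0 \<le> of_int n * ?i" using \<open>c * \<rho> / 8 \<le> of_int n * ?i\<close> c_pos \<rho>
        by (smt (verit) divide_nonneg_pos mult_nonneg_nonneg)
      then show "0 \<le> ?i" using n0 by (simp add: zero_le_mult_iff)
    qed
    finally have "\<rho> * (c * norm w / 4) \<le> \<rho> * ?i" by (simp add: field_simps)
    then have "c * norm w / 4 \<le> ?i" using \<rho> by (rule mult_left_le_imp_le)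
    then show ?thesis using u by auto
  qed
  have "ennreal ((c * norm w / 2) * measure lborel (ball (0::'a) \<tau>) * norm w / (3 * \<tau>))
    \<le> (\<integral>\<^sup>+t. ennreal (excess_kink \<phi> \<eta> w \<delta> t) * indicator (ball 0 \<rho>) t \<partial>lborel)"
  proof (rule nn_integral_ge_shift_average[where n = n])
    show "t + of_int k *\<^sub>R w \<in> ball 0 \<rho>" if "t \<in> ball 0 \<tau>" "\<bar>k\<bar> \<le> n" for t k
    proof -
      have "real_of_int \<bar>k\<bar> \<le> of_int n" using that(2) by linarith
      then have "norm (of_int k *\<^sub>R w) \<le> \<rho> / 2"
        using n1 mult_right_mono[of "\<bar>real_of_int k\<bar>" "of_int n" "norm w"] by simp
      then show ?thesis using that(1) \<tau> norm_triangle_ineq[of t "of_int k *\<^sub>R w"] by simp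
    qed
  next
    fix t :: 'a assume t: "t \<in> ball 0 \<tau>"
    define P where "P = (\<lambda>k::int. max 0 (\<phi> (t + of_int k *\<^sub>R w) - (\<eta> + \<delta>)))"
    define N where "N = (\<lambda>k::int. max 0 (\<phi> (t + of_int k *\<^sub>R w) - (\<eta> - \<delta>)))"
    \<comment> \<open>Joint convexity replaces the middle term by the average of the two shifted levels.\<close>
    have summand: "(N (k + 1) - N k) - (P k - P (k - 1)) \<le> excess_kink \<phi> \<eta> w \<delta> (t + of_int k *\<^sub>R w)" for k
    proof -
      have "excess_kink \<phi> \<eta> w \<delta> (t + of_int k *\<^sub>R w)
          = P (k - 1) + N (k + 1) - 2 * max 0 (\<phi> (t + of_int k *\<^sub>R w) - \<eta>)"
        by (simp add: excess_kink_def P_def N_def algebra_simps)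
      moreover have "2 * max 0 (\<phi> (t + of_int k *\<^sub>R w) - \<eta>) \<le> P k + N k"
        unfolding P_def N_def by (rule excess_midpoint) (simp_all add: scaleR_2)
      ultimately show ?thesis by linarith
    qed
    have "N (n + 1) - N (- n) - (P n - P (- n - 1))
        = (\<Sum>k\<in>{-n..n}. (N (k + 1) - N k)) - (\<Sum>k\<in>{-n..n}. (P k - P (k - 1)))"
      using sum_telescope_int[of "-n" n N] sum_telescope_int[of "-n" n "\<lambda>k. P (k - 1)"] n0 by simp
    also have "\<dots> \<le> (\<Sum>k\<in>{-n..n}. excess_kink \<phi> \<eta> w \<delta> (t + of_int k *\<^sub>R w))"
      unfolding sum_subtractf[symmetric] by (intro sum_mono summand)
    also have "N (n + 1) - N (- n) - (P n - P (- n - 1))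
        = (\<phi> (t + (of_int n + 1) *\<^sub>R w) - \<phi> (t + of_int n *\<^sub>R w))
          + (\<phi> (t + (of_int n + 1) *\<^sub>R (- w)) - \<phi> (t + of_int n *\<^sub>R (- w)))"
    proof -
      have pos: "\<eta> + \<delta> \<le> \<phi> (t + x *\<^sub>R w)" "\<eta> - \<delta> \<le> \<phi> (t + x *\<^sub>R w)" if "of_int n \<le> \<bar>x\<bar>" for x
        using far[OF t that] \<eta> by linarith+
      have "N (n + 1) = \<phi> (t + (of_int n + 1) *\<^sub>R w) - (\<eta> - \<delta>)"
        using pos[of "of_int n + 1"] n0 by (simp add: N_def)
      moreover have "N (- n) = \<phi> (t + of_int n *\<^sub>R (- w)) - (\<eta> - \<delta>)"
        using pos[of "- of_int n"] n0 by (simp add: N_def)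
      moreover have "P n = \<phi> (t + of_int n *\<^sub>R w) - (\<eta> + \<delta>)"
        using pos[of "of_int n"] n0 by (simp add: P_def)
      moreover have "P (- n - 1) = \<phi> (t + (of_int n + 1) *\<^sub>R (- w)) - (\<eta> + \<delta>)"
        using pos[of "- of_int n - 1"] n0 by (simp add: P_def algebra_simps)
      ultimately show ?thesis by simp
    qed
    finally have "c * norm w / 2 \<le> (\<Sum>k\<in>{-n..n}. excess_kink \<phi> \<eta> w \<delta> (t + of_int k *\<^sub>R w))"
      using increment[OF t, of w] increment[OF t, of "- w"] by simp
    then show "ennreal (c * norm w / 2)
        \<le> (\<Sum>k\<in>{-n..n}. ennreal (excess_kink \<phi> \<eta> w \<delta> (t + of_int k *\<^sub>R w)))"
      by (simp add: sum_ennreal excess_kink_nonneg ennreal_leI)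
  qed (use w c_pos in auto)
  also have "(c * norm w / 2) * measure lborel (ball (0::'a) \<tau>) * norm w / (3 * \<tau>)
      = c * (norm w)\<^sup>2 * measure lborel (ball (0::'a) \<tau>) / (6 * \<tau>)"
    by (simp add: power2_eq_square)
  finally show ?thesis .
qed

text \<open>The maximisers of \<open>d \<bullet> x\<close> and of \<open>d \<bullet> (- x)\<close> have values of \<open>d \<bullet> x\<close> at least \<open>2 * c * norm x\<close> apart.\<close>
lemma ex_vertex_speed:
  "\<exists>d\<in>E. c * norm x \<le> \<bar>d \<bullet> x + y\<bar>"
proof -
  obtain d where d: "d \<in> E" "\<phi> x = d \<bullet> x" using attained by blast
  obtain d' where d': "d' \<in> E" "\<phi> (- x) = d' \<bullet> (- x)" using attained by blast
  have "c * norm x + c * norm x \<le> (d \<bullet> x + y) - (d' \<bullet> x + y)"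
    using coercive[of x] coercive[of "- x"] d d' by simp
  then have "c * norm x \<le> \<bar>d \<bullet> x + y\<bar> \<or> c * norm x \<le> \<bar>d' \<bullet> x + y\<bar>" by linarith
  then show ?thesis using d d' by blast
qed

text \<open>Below the level \<open>c * \<rho> / 8\<close> the kinks near the origin are used, above it the cuts \<open>d \<bullet> t = \<eta>\<close>. The
ball given at level \<open>\<eta>0\<close> is scaled to the level \<open>\<eta>\<close>; the scaling factor is bounded away from \<open>0\<close>, so
one radius serves all levels, and finiteness of \<open>E\<close> makes it serve all vertices. How small \<open>e\<close> has to be
depends on the direction, the constant does not.\<close>
lemma uniform_kink_gain:
  assumes "\<rho> > 0" "\<eta>0 > 0"
    and balls: "\<And>d. d \<in> E \<Longrightarrow> \<exists>p \<tau>. 0 < \<tau> \<and> d \<bullet> p = \<eta>0 \<and> ball p \<tau> \<subseteq> {t. \<phi> t = d \<bullet> t} \<inter> ball 0 \<rho>"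
  shows "\<exists>\<kappa>>0. \<forall>\<eta> x y. \<eta> \<le> \<eta>0 \<longrightarrow> x \<noteq> 0 \<longrightarrow> (\<forall>\<^sub>F e in at_right 0.
    ennreal (\<kappa> * (e * norm x)\<^sup>2)
      \<le> (\<integral>\<^sup>+t. ennreal (excess_kink \<phi> \<eta> (e *\<^sub>R x) (e * y) t) * indicator (ball 0 \<rho>) t \<partial>lborel))"
proof -
  obtain C where C: "C > 0" "\<And>d. d \<in> E \<Longrightarrow> norm d \<le> C" "\<And>t. \<phi> t \<le> C * norm t"
    using obtain_bound by metis
  define vol where "vol = (\<lambda>\<tau>. measure lborel (ball (0::'a) \<tau>))"
  have vol_pos: "vol \<tau> > 0" if "\<tau> > 0" for \<tau>
    using that by (simp add: vol_def content_ball)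
  have vol_ball: "measure lborel (ball p \<tau>) = vol \<tau>" if "\<tau> > 0" for p :: 'a and \<tau>
    using that by (simp add: vol_def content_ball)
  obtain p T where pT: "\<And>d. d \<in> E \<Longrightarrow> 0 < T d \<and> d \<bullet> p d = \<eta>0 \<and> ball (p d) (T d) \<subseteq> {t. \<phi> t = d \<bullet> t} \<inter> ball 0 \<rho>"
    using balls by metis
  have "E \<noteq> {}" using attained by blast
  define T0 where "T0 = Min (T ` E)"
  have T0: "0 < T0" "\<And>d. d \<in> E \<Longrightarrow> T0 \<le> T d"
    using finite_E \<open>E \<noteq> {}\<close> pT by (auto simp: T0_def)
  \<comment> \<open>Half of the level allowed for kinks near the origin; the other half absorbs the step in the level.\<close>
  define \<eta>' where "\<eta>' = c * \<rho> / 8"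
  define \<tau>0 where "\<tau>0 = min (\<rho> / 8) (c * \<rho> / (8 * C))"
  \<comment> \<open>The scaling factor is at least the quotient of the levels; the cut bound needs room for five radii.\<close>
  define \<tau>1 where "\<tau>1 = T0 * (\<eta>' / \<eta>0) / 5"
  have "\<eta>' > 0" using c_pos \<open>\<rho> > 0\<close> by (simp add: \<eta>'_def)
  have \<tau>0: "0 < \<tau>0" "\<tau>0 \<le> \<rho> / 8" "C * \<tau>0 \<le> c * \<rho> / 8"
  proof -
    show "0 < \<tau>0" "\<tau>0 \<le> \<rho> / 8" using c_pos C \<open>\<rho> > 0\<close> by (auto simp: \<tau>0_def)
    have "C * \<tau>0 \<le> C * (c * \<rho> / (8 * C))" using C(1) by (intro mult_left_mono) (auto simp: \<tau>0_def)
    then show "C * \<tau>0 \<le> c * \<rho> / 8" using C(1) by simp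
  qed
  have \<tau>1: "0 < \<tau>1" using T0 \<open>\<eta>' > 0\<close> \<open>\<eta>0 > 0\<close> by (simp add: \<tau>1_def)
  define \<kappa>0 where "\<kappa>0 = c * vol \<tau>0 / (6 * \<tau>0)"
  define \<kappa>1 where "\<kappa>1 = c\<^sup>2 * vol \<tau>1 / (6 * \<tau>1 * C)"
  have \<kappa>: "0 < \<kappa>0" "0 < \<kappa>1" using c_pos C \<tau>0 \<tau>1 vol_pos by (simp_all add: \<kappa>0_def \<kappa>1_def)
  have apex: "\<forall>\<^sub>F e in at_right 0. ennreal (min \<kappa>0 \<kappa>1 * (e * norm x)\<^sup>2)
      \<le> (\<integral>\<^sup>+t. ennreal (excess_kink \<phi> \<eta> (e *\<^sub>R x) (e * y) t) * indicator (ball 0 \<rho>) t \<partial>lborel)"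
    if "\<eta> \<le> \<eta>'" "x \<noteq> 0" for \<eta> x y
    using eventually_small_multiple[OF \<tau>0(1), of "norm x"] eventually_small_multiple[OF \<open>\<eta>' > 0\<close>, of "\<bar>y\<bar>"]
      eventually_at_right_less
  proof eventually_elim
    case (elim e)
    have gain: "ennreal (c * (norm (e *\<^sub>R x))\<^sup>2 * measure lborel (ball (0::'a) \<tau>0) / (6 * \<tau>0))
        \<le> (\<integral>\<^sup>+t. ennreal (excess_kink \<phi> \<eta> (e *\<^sub>R x) (e * y) t) * indicator (ball 0 \<rho>) t \<partial>lborel)"
      by (rule apex_kink_gain[OF C(3,1) \<tau>0]) (use that elim in \<open>auto simp: \<eta>'_def abs_mult\<close>)
    have "min \<kappa>0 \<kappa>1 * (e * norm x)\<^sup>2 \<le> \<kappa>0 * (e * norm x)\<^sup>2"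
      by (intro mult_right_mono) auto
    also have "\<dots> = c * (norm (e *\<^sub>R x))\<^sup>2 * measure lborel (ball (0::'a) \<tau>0) / (6 * \<tau>0)"
      by (simp add: \<kappa>0_def vol_def power_mult_distrib)
    finally show ?case by (rule order_trans[OF ennreal_leI gain])
  qed
  have cut: "\<forall>\<^sub>F e in at_right 0. ennreal (min \<kappa>0 \<kappa>1 * (e * norm x)\<^sup>2)
      \<le> (\<integral>\<^sup>+t. ennreal (excess_kink \<phi> \<eta> (e *\<^sub>R x) (e * y) t) * indicator (ball 0 \<rho>) t \<partial>lborel)"
    if \<eta>: "\<eta>' < \<eta>" "\<eta> \<le> \<eta>0" and x: "x \<noteq> 0" for \<eta> x y
  proof -
    obtain d where d: "d \<in> E" "c * norm x \<le> \<bar>d \<bullet> x + y\<bar>" using ex_vertex_speed by blast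
    define s where "s = \<eta> / \<eta>0"
    have s: "0 < s" "s \<le> 1" "\<eta>' / \<eta>0 \<le> s"
      using \<eta> \<open>\<eta>' > 0\<close> \<open>\<eta>0 > 0\<close> by (auto simp: s_def divide_right_mono)
    have "d \<noteq> 0" using pT[OF d(1)] \<open>\<eta>0 > 0\<close> by auto
    have inside: "t \<in> {t. \<phi> t = d \<bullet> t} \<inter> ball 0 \<rho>" if t: "t \<in> ball (s *\<^sub>R p d) (5 * \<tau>1)" for t
    proof -
      have "5 * \<tau>1 \<le> T0 * s" using mult_left_mono[OF s(3), of T0] T0(1) by (simp add: \<tau>1_def)
      also have "\<dots> \<le> T d * s" using T0(2)[OF d(1)] s by (intro mult_right_mono) auto
      finally have "norm (s *\<^sub>R p d - t) < s * T d" using t by (simp add: dist_norm mult.commute)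
      moreover have "s *\<^sub>R p d - t = s *\<^sub>R (p d - (1 / s) *\<^sub>R t)" using s by (simp add: scaleR_diff_right)
      ultimately have "norm (p d - (1 / s) *\<^sub>R t) < T d" using s by simp
      then have "(1 / s) *\<^sub>R t \<in> {t. \<phi> t = d \<bullet> t} \<inter> ball 0 \<rho>" using pT[OF d(1)] by (auto simp: dist_norm)
      then have "\<phi> t = d \<bullet> t" "norm t / s < \<rho>" using s by (auto simp: homogeneous)
      moreover have "norm t \<le> norm t / s" using s by (simp add: le_divide_eq mult_left_le)
      ultimately show ?thesis by simp
    qed
    have "0 < \<tau>1 * norm d" using \<tau>1 \<open>d \<noteq> 0\<close> by simp
    from eventually_small_multiple[OF this, of "\<bar>d \<bullet> x + y\<bar>"] eventually_small_multiple[OF \<tau>1, of "norm x"]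
      eventually_at_right_less
    show ?thesis
    proof eventually_elim
      case (elim e)
      define b where "b = \<bar>d \<bullet> (e *\<^sub>R x) + e * y\<bar>"
      have b: "b = e * \<bar>d \<bullet> x + y\<bar>" using elim by (simp add: b_def abs_mult flip: distrib_left)
      have ebx: "e * (c * norm x) \<le> b" unfolding b using d(2) elim by (intro mult_left_mono) auto
      moreover have "0 < e * (c * norm x)" using c_pos x elim by simp
      ultimately have "0 < b" by linarith
      have gain: "ennreal (b\<^sup>2 * measure lborel (ball (s *\<^sub>R p d) \<tau>1) / (6 * \<tau>1 * norm d))
        \<le> (\<integral>\<^sup>+t. ennreal (excess_kink \<phi> \<eta> (e *\<^sub>R x) (e * y) t) * indicator (ball 0 \<rho>) t \<partial>lborel)"
      proof (rule cut_kink_gain[OF _ _ _ _ b_def \<open>0 < b\<close>])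
        show "d \<bullet> (s *\<^sub>R p d) = \<eta>" using pT[OF d(1)] \<open>\<eta>0 > 0\<close> by (simp add: s_def)
      qed (use inside elim in \<open>auto simp: b\<close>)
      have "min \<kappa>0 \<kappa>1 * (e * norm x)\<^sup>2 \<le> b\<^sup>2 * vol \<tau>1 / (6 * \<tau>1 * norm d)"
      proof -
        have "min \<kappa>0 \<kappa>1 * (e * norm x)\<^sup>2 \<le> \<kappa>1 * (e * norm x)\<^sup>2"
          by (intro mult_right_mono) auto
        also have "\<dots> = (e * (c * norm x))\<^sup>2 * vol \<tau>1 / (6 * \<tau>1 * C)"
          by (simp add: \<kappa>1_def power_mult_distrib)
        also have "\<dots> \<le> b\<^sup>2 * vol \<tau>1 / (6 * \<tau>1 * C)"
          using ebx \<open>0 < e * (c * norm x)\<close> vol_pos[OF \<tau>1] \<tau>1 C(1)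
          by (intro divide_right_mono mult_right_mono power_mono) auto
        also have "\<dots> \<le> b\<^sup>2 * vol \<tau>1 / (6 * \<tau>1 * norm d)"
          using vol_pos[OF \<tau>1] \<tau>1 C(1) C(2)[OF d(1)] \<open>d \<noteq> 0\<close> by (intro divide_left_mono mult_left_mono) auto
        finally show ?thesis .
      qed
      then show ?case by (rule order_trans[OF ennreal_leI gain[unfolded vol_ball[OF \<tau>1]]])
    qed
  qed
  show ?thesis
  proof (intro exI[of _ "min \<kappa>0 \<kappa>1"] conjI allI impI)
    fix \<eta> y :: real and x :: 'a assume "\<eta> \<le> \<eta>0" "x \<noteq> 0"
    then show "\<forall>\<^sub>F e in at_right 0. ennreal (min \<kappa>0 \<kappa>1 * (e * norm x)\<^sup>2)
      \<le> (\<integral>\<^sup>+t. ennreal (excess_kink \<phi> \<eta> (e *\<^sub>R x) (e * y) t) * indicator (ball 0 \<rho>) t \<partial>lborel)"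
      using apex[of \<eta> x y] cut[of \<eta> x y] by (cases "\<eta> \<le> \<eta>'") auto
  qed (use \<kappa> in simp)
qed

end

section \<open>Partial strong convexity of the expected excess\<close>

locale expected_gauge = polyhedral_gauge E \<phi> c + prob_space \<mu>
  for E :: "'a::euclidean_space set" and \<phi> c and \<mu> :: "'a measure" +
  assumes sets_\<mu> [measurable_cong]: "sets \<mu> = sets borel"
    and integrable_norm: "integrable \<mu> norm"
begin

definition mean_excess :: "'a \<times> real \<Rightarrow> real" where
  "mean_excess = (\<lambda>(x, \<eta>). LINT z|\<mu>. max 0 (\<phi> (z - x) - \<eta>))"

lemma integrable_excess: "integrable \<mu> (\<lambda>z. max 0 (\<phi> (z - x) - \<eta>))"
proof -
  obtain C where C: "C > 0" "\<And>t. \<phi> t \<le> C * norm t" by (rule obtain_bound) blast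
  show ?thesis
  proof (rule Bochner_Integration.integrable_bound)
    show "integrable \<mu> (\<lambda>z. C * norm z + (C * norm x + \<bar>\<eta>\<bar>))"
      using integrable_norm by simp
    show "AE z in \<mu>. norm (max 0 (\<phi> (z - x) - \<eta>)) \<le> norm (C * norm z + (C * norm x + \<bar>\<eta>\<bar>))"
    proof (rule AE_I2)
      fix z
      have "\<phi> (z - x) \<le> C * (norm z + norm x)"
        using order_trans[OF C(2)[of "z - x"] mult_left_mono[OF norm_triangle_ineq4[of z x]]] C(1)
        by (simp add: less_imp_le)
      moreover have "0 \<le> C * norm z" "0 \<le> C * norm x" using C(1) by auto
      ultimately show "norm (max 0 (\<phi> (z - x) - \<eta>)) \<le> norm (C * norm z + (C * norm x + \<bar>\<eta>\<bar>))"
        by (simp add: distrib_left)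
    qed
  qed measurable
qed

text \<open>Besides the case of equal first components, this supplies the continuity of the expected excess along
segments.\<close>
lemma convex_mean_excess: "convex_on UNIV mean_excess"
proof (rule convex_onI)
  fix u :: real and a b :: "'a \<times> real"
  assume u: "0 < u" "u < 1"
  obtain x \<eta> x' \<eta>' where ab: "a = (x, \<eta>)" "b = (x', \<eta>')" by (cases a, cases b)
  have "(LINT z|\<mu>. max 0 (\<phi> (z - ((1 - u) *\<^sub>R x + u *\<^sub>R x')) - ((1 - u) * \<eta> + u * \<eta>')))
      \<le> (LINT z|\<mu>. (1 - u) * max 0 (\<phi> (z - x) - \<eta>) + u * max 0 (\<phi> (z - x') - \<eta>'))"
  proof (intro integral_mono integrable_excess Bochner_Integration.integrable_add integrable_mult_right)
    fix z
    have "z - ((1 - u) *\<^sub>R x + u *\<^sub>R x') = (1 - u) *\<^sub>R (z - x) + u *\<^sub>R (z - x')"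
      by (simp add: algebra_simps)
    then have "\<phi> (z - ((1 - u) *\<^sub>R x + u *\<^sub>R x')) - ((1 - u) * \<eta> + u * \<eta>')
        \<le> (1 - u) * (\<phi> (z - x) - \<eta>) + u * (\<phi> (z - x') - \<eta>')"
      using convex_onD[OF convex_gauge, of u "z - x" "z - x'"] u by (simp add: algebra_simps)
    also have "\<dots> \<le> (1 - u) * max 0 (\<phi> (z - x) - \<eta>) + u * max 0 (\<phi> (z - x') - \<eta>')"
      using u by (intro add_mono mult_left_mono) auto
    finally show "max 0 (\<phi> (z - ((1 - u) *\<^sub>R x + u *\<^sub>R x')) - ((1 - u) * \<eta> + u * \<eta>'))
        \<le> (1 - u) * max 0 (\<phi> (z - x) - \<eta>) + u * max 0 (\<phi> (z - x') - \<eta>')"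
      using u by simp
  qed
  also have "\<dots> = (1 - u) * (LINT z|\<mu>. max 0 (\<phi> (z - x) - \<eta>)) + u * (LINT z|\<mu>. max 0 (\<phi> (z - x') - \<eta>'))"
    by (simp add: integrable_excess)
  finally show "mean_excess ((1 - u) *\<^sub>R a + u *\<^sub>R b) \<le> (1 - u) * mean_excess a + u * mean_excess b"
    by (simp add: mean_excess_def ab)
qed simp

text \<open>The second difference of the excess is nonnegative, so the part of the integral outside the ball
around \<open>x\<close>, where nothing is known about the density, can be dropped.\<close>
lemma second_difference_ge:
  assumes \<theta>: "\<theta> \<in> borel_measurable lborel" "\<mu> = density lborel \<theta>"
    and r: "r > 0" "AE z in lborel. z \<in> V + ball 0 \<rho> \<longrightarrow> ennreal r \<le> \<theta> z"
    and x: "x \<in> V" and g: "0 \<le> g"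
    and gain: "ennreal g \<le> (\<integral>\<^sup>+t. ennreal (excess_kink \<phi> \<eta> w \<delta> t) * indicator (ball 0 \<rho>) t \<partial>lborel)"
  shows "r * g \<le> mean_excess (x + w, \<eta> + \<delta>) + mean_excess (x - w, \<eta> - \<delta>) - 2 * mean_excess (x, \<eta>)"
proof -
  have [measurable]: "\<theta> \<in> borel_measurable borel" using \<theta>(1) by simp
  let ?k = "\<lambda>z. excess_kink \<phi> \<eta> w \<delta> (z - x)"
  have [measurable]: "ball (0::'a) \<rho> \<in> sets borel" by simp
  have [measurable]: "(\<lambda>z. indicator (ball 0 \<rho>) (z - x) :: ennreal) \<in> borel_measurable borel"
    by (rule measurable_compose[where N = borel and g = "indicator (ball 0 \<rho>)"])
       (auto intro!: borel_measurable_indicator)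
  have k: "?k = (\<lambda>z. max 0 (\<phi> (z - (x + w)) - (\<eta> + \<delta>)) + max 0 (\<phi> (z - (x - w)) - (\<eta> - \<delta>))
      - 2 * max 0 (\<phi> (z - x) - \<eta>))"
    by (auto simp: excess_kink_def algebra_simps)
  have int: "integrable \<mu> ?k" unfolding k by (simp add: integrable_excess)
  have eq: "mean_excess (x + w, \<eta> + \<delta>) + mean_excess (x - w, \<eta> - \<delta>) - 2 * mean_excess (x, \<eta>) = (LINT z|\<mu>. ?k z)"
    unfolding k by (simp add: mean_excess_def integrable_excess)
  have "ennreal (r * g) = ennreal r * ennreal g" using r(1) g by (simp add: ennreal_mult)
  also have "\<dots> \<le> ennreal r * (\<integral>\<^sup>+t. ennreal (excess_kink \<phi> \<eta> w \<delta> t) * indicator (ball 0 \<rho>) t \<partial>lborel)"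
    by (intro mult_left_mono gain) simp
  also have "\<dots> = ennreal r * (\<integral>\<^sup>+z. ennreal (?k z) * indicator (ball 0 \<rho>) (z - x) \<partial>lborel)"
  proof -
    have "(\<integral>\<^sup>+z. ennreal (excess_kink \<phi> \<eta> w \<delta> (- x + z)) * indicator (ball 0 \<rho>) (- x + z) \<partial>lborel)
        = (\<integral>\<^sup>+t. ennreal (excess_kink \<phi> \<eta> w \<delta> t) * indicator (ball 0 \<rho>) t \<partial>lborel)"
      by (rule nn_integral_translate) measurable
    then show ?thesis by simp
  qed
  also have "\<dots> = (\<integral>\<^sup>+z. ennreal r * (ennreal (?k z) * indicator (ball 0 \<rho>) (z - x)) \<partial>lborel)"
    by (rule nn_integral_cmult[symmetric]) measurable
  also have "\<dots> \<le> (\<integral>\<^sup>+z. \<theta> z * ennreal (?k z) \<partial>lborel)"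
  proof (rule nn_integral_mono_AE)
    show "AE z in lborel. ennreal r * (ennreal (?k z) * indicator (ball 0 \<rho>) (z - x)) \<le> \<theta> z * ennreal (?k z)"
      using r(2)
    proof eventually_elim
      case (elim z)
      show ?case
      proof (cases "z - x \<in> ball 0 \<rho>")
        case True
        then have "x + (z - x) \<in> V + ball 0 \<rho>" using x by (rule_tac set_plus_intro)
        then show ?thesis using elim True by (simp add: mult_right_mono)
      qed simp
    qed
  qed
  also have "\<dots> = (\<integral>\<^sup>+z. ennreal (?k z) \<partial>\<mu>)"
    unfolding \<theta>(2) by (rule nn_integral_density[symmetric]) measurable
  also have "\<dots> = ennreal (LINT z|\<mu>. ?k z)"
    by (rule nn_integral_eq_integral[OF int]) (simp add: excess_kink_nonneg)
  finally show ?thesis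
    unfolding eq by (subst (asm) ennreal_le_iff) (simp_all add: excess_kink_nonneg)
qed

text \<open>Restricted to a segment with end points in the region, the expected excess has second differences
of at least twice the required quadratic term for small steps, since \<open>K\<close> is half of the available constant; this gives the
strict inequality that locality of strong convexity needs.\<close>
lemma partially_strongly_convex_mean_excess:
  assumes \<theta>: "\<theta> \<in> borel_measurable lborel" "\<mu> = density lborel \<theta>"
    and r: "r > 0" "AE z in lborel. z \<in> V + ball 0 \<rho> \<longrightarrow> ennreal r \<le> \<theta> z"
    and V: "convex V" and pos: "\<rho> > 0" "\<eta>0 > 0"
    and balls: "\<And>d. d \<in> E \<Longrightarrow> \<exists>p \<tau>. 0 < \<tau> \<and> d \<bullet> p = \<eta>0 \<and> ball p \<tau> \<subseteq> {t. \<phi> t = d \<bullet> t} \<inter> ball 0 \<rho>"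
  shows "partially_strongly_convex_on (V \<times> {..\<eta>0}) mean_excess"
proof -
  obtain \<kappa> where \<kappa>: "\<kappa> > 0"
    and gain: "\<And>\<eta> x y. \<eta> \<le> \<eta>0 \<Longrightarrow> x \<noteq> 0 \<Longrightarrow> \<forall>\<^sub>F e in at_right 0. ennreal (\<kappa> * (e * norm x)\<^sup>2)
      \<le> (\<integral>\<^sup>+t. ennreal (excess_kink \<phi> \<eta> (e *\<^sub>R x) (e * y) t) * indicator (ball 0 \<rho>) t \<partial>lborel)"
    using uniform_kink_gain[OF pos balls] by blast
  define K where "K = r * \<kappa> / 2"
  have "K > 0" using r(1) \<kappa> by (simp add: K_def)
  have "mean_excess (l *\<^sub>R (x1, \<eta>1) + (1 - l) *\<^sub>R (x2, \<eta>2))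
      \<le> l * mean_excess (x1, \<eta>1) + (1 - l) * mean_excess (x2, \<eta>2) - K / 2 * l * (1 - l) * (norm (x1 - x2))\<^sup>2"
    if x: "x1 \<in> V" "x2 \<in> V" and \<eta>: "\<eta>1 \<le> \<eta>0" "\<eta>2 \<le> \<eta>0" and l: "0 < l" "l < 1" for x1 x2 \<eta>1 \<eta>2 l
  proof (cases "x1 = x2")
    case True
    then show ?thesis
      using convex_onD[OF convex_mean_excess, of l "(x2, \<eta>2)" "(x1, \<eta>1)"] l by (simp add: add.commute)
  next
    case False
    define h where "h = (\<lambda>t. mean_excess (x2 + t *\<^sub>R (x1 - x2), \<eta>2 + t * (\<eta>1 - \<eta>2)))"
    have "h l \<le> l * h 1 + (1 - l) * h 0 - (K * (norm (x1 - x2))\<^sup>2) / 2 * l * (1 - l)"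
    proof (rule strong_convexity_gap)
      have "continuous_on UNIV mean_excess" using open_UNIV convex_mean_excess by (rule convex_on_continuous)
      then show "continuous_on {0..1} h"
        unfolding h_def by (rule continuous_on_compose2) (auto intro!: continuous_intros)
    next
      fix t :: real assume t: "0 < t" "t < 1"
      define xt where "xt = x2 + t *\<^sub>R (x1 - x2)"
      define yt where "yt = \<eta>2 + t * (\<eta>1 - \<eta>2)"
      have "xt = (1 - t) *\<^sub>R x2 + t *\<^sub>R x1" by (simp add: xt_def algebra_simps)
      then have "xt \<in> V" using convexD_alt[OF V x(2,1), of t] t by simp
      have "yt \<le> \<eta>0"
        using convex_bound_le[of \<eta>2 \<eta>0 \<eta>1 "1 - t" t] \<eta> t by (simp add: yt_def algebra_simps)
      have "x1 - x2 \<noteq> 0" using False by simp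
      from gain[OF \<open>yt \<le> \<eta>0\<close> this, of "\<eta>1 - \<eta>2"]
        eventually_small_multiple[of t 1] eventually_small_multiple[of "1 - t" 1] eventually_at_right_less[of 0]
      have "\<forall>\<^sub>F e in at_right 0. 0 < e \<and> e < t \<and> e < 1 - t \<and> ennreal (\<kappa> * (e * norm (x1 - x2))\<^sup>2)
        \<le> (\<integral>\<^sup>+s. ennreal (excess_kink \<phi> yt (e *\<^sub>R (x1 - x2)) (e * (\<eta>1 - \<eta>2)) s)
              * indicator (ball 0 \<rho>) s \<partial>lborel)"
        using t by (simp add: eventually_conj_iff)
      then obtain e where e: "0 < e" "e < t" "e < 1 - t" "ennreal (\<kappa> * (e * norm (x1 - x2))\<^sup>2)
        \<le> (\<integral>\<^sup>+s. ennreal (excess_kink \<phi> yt (e *\<^sub>R (x1 - x2)) (e * (\<eta>1 - \<eta>2)) s)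
              * indicator (ball 0 \<rho>) s \<partial>lborel)"
        using eventually_happens'[OF trivial_limit_at_right_real] by blast
      have "r * (\<kappa> * (e * norm (x1 - x2))\<^sup>2) \<le> mean_excess (xt + e *\<^sub>R (x1 - x2), yt + e * (\<eta>1 - \<eta>2))
          + mean_excess (xt - e *\<^sub>R (x1 - x2), yt - e * (\<eta>1 - \<eta>2)) - 2 * mean_excess (xt, yt)"
        using \<kappa> by (intro second_difference_ge[OF \<theta> r \<open>xt \<in> V\<close> _ e(4)]) simp
      also have "\<dots> = h (t + e) + h (t - e) - 2 * h t"
        by (simp add: h_def xt_def yt_def algebra_simps)
      finally have "2 * (K * (norm (x1 - x2))\<^sup>2 * e\<^sup>2) \<le> h (t + e) + h (t - e) - 2 * h t"
        by (simp add: K_def power_mult_distrib mult_ac)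
      moreover have "0 < K * (norm (x1 - x2))\<^sup>2 * e\<^sup>2" using \<open>K > 0\<close> False e by simp
      ultimately have "K * (norm (x1 - x2))\<^sup>2 * e\<^sup>2 < h (t + e) + h (t - e) - 2 * h t" by linarith
      then show "\<exists>e>0. e \<le> t \<and> e \<le> 1 - t \<and> K * (norm (x1 - x2))\<^sup>2 * e\<^sup>2 < h (t + e) + h (t - e) - 2 * h t"
        using e by (intro exI[of _ e]) auto
    qed (use l in auto)
    moreover have "h l = mean_excess (l *\<^sub>R (x1, \<eta>1) + (1 - l) *\<^sub>R (x2, \<eta>2))"
      by (simp add: h_def algebra_simps)
    moreover have "h 1 = mean_excess (x1, \<eta>1)" "h 0 = mean_excess (x2, \<eta>2)" by (simp_all add: h_def)
    ultimately show ?thesis by (simp add: mult_ac)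
  qed
  then show ?thesis
    unfolding partially_strongly_convex_on_def using \<open>K > 0\<close> by (intro exI[of _ K]) auto
qed

end

lemma recourse_polyhedral_gauge:
  fixes W :: "real^'m^'s"
  assumes A1: "\<forall>t. \<exists>y. (\<forall>j. 0 \<le> y $ j) \<and> W *v y = t" and A6: "\<forall>j. q $ j > 0"
  obtains c where "polyhedral_gauge (dual_vertices W q) (recourse W q) c"
proof -
  note S = recourse_support[OF A1 A6]
  obtain c where "c > 0" "\<And>t. c * norm t \<le> recourse W q t" using S(4) by blast
  then have "polyhedral_gauge (dual_vertices W q) (recourse W q) c"
    using S(1-3) by unfold_locales auto
  then show thesis by (rule that)
qed

theorem theorem2p3:
  fixes W :: "real^'m^'s" and q :: "real^'m" and \<mu> :: "(real^'s) measure"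
    and \<theta> :: "real^'s \<Rightarrow> ennreal" and V :: "(real^'s) set" and r \<rho> \<eta>0 :: real
  assumes "prob_space \<mu>" and "sets \<mu> = sets borel"
    and A1: "\<forall>t. \<exists>y. (\<forall>j. 0 \<le> y $ j) \<and> W *v y = t"
    and A2: "\<exists>v. \<forall>j. (transpose W *v v) $ j < q $ j"
    and A3: "integrable \<mu> (\<lambda>z. norm z)"
    and A4: "\<theta> \<in> borel_measurable lborel" "\<mu> = density lborel \<theta>"
      "convex V" "open V" "r > 0" "\<rho> > 0"
      "AE z in lborel. z \<in> V + ball 0 \<rho> \<longrightarrow> ennreal r \<le> \<theta> z"
    and A5: "\<eta>0 > 0" "\<forall>d\<in>pos_vertices W q. norm (min_ray_point W q d \<eta>0) < \<rho>"
    and A6: "\<forall>j. q $ j > 0"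
  shows "partially_strongly_convex_on (V \<times> {..\<eta>0}) (expected_excess W q \<mu>)"
proof -
  let ?E = "dual_vertices W q" and ?\<phi> = "recourse W q"
  obtain c where gauge: "polyhedral_gauge ?E ?\<phi> c"
    using recourse_polyhedral_gauge[OF A1 A6] .
  interpret expected_gauge ?E ?\<phi> c \<mu>
    using gauge assms(1,2) A3 by (simp add: expected_gauge_def expected_gauge_axioms_def)
  have "\<exists>p \<tau>. 0 < \<tau> \<and> d \<bullet> p = \<eta>0 \<and> ball p \<tau> \<subseteq> {t. ?\<phi> t = d \<bullet> t} \<inter> ball 0 \<rho>" if d: "d \<in> ?E" for d
  proof -
    have "norm (min_ray_point W q d \<eta>0) < \<rho>"
      using A5(2) d unfolding pos_vertices_eq[OF A1 A6] by blast
    moreover have "vertex_cone W q d \<subseteq> {t. ?\<phi> t = d \<bullet> t}"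
    proof
      fix t assume t: "t \<in> vertex_cone W q d"
      obtain d' where d': "d' \<in> ?E" "?\<phi> t = d' \<bullet> t" using attained by blast
      then have "?\<phi> t \<le> d \<bullet> t" using t by (auto simp: vertex_cone_def inner_diff_left)
      then show "t \<in> {t. ?\<phi> t = d \<bullet> t}" using upper[OF d, of t] by simp
    qed
    ultimately show ?thesis using level_ball_in_vertex_cone[OF A1 A6 A5(1) d, of \<rho>] by blast
  qed
  then have "partially_strongly_convex_on (V \<times> {..\<eta>0}) mean_excess"
    by (rule partially_strongly_convex_mean_excess[OF A4(1,2,5,7,3,6) A5(1)])
  moreover have "mean_excess = expected_excess W q \<mu>" by (simp add: mean_excess_def expected_excess_def)
  ultimately show ?thesis by simp
qed

end
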